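(* For every $c>0$ and every $$B>\beta_\ast+\frac{\log2}{c},$$ there is a constant $C_{B,c}<\infty$ such that, for every integer $R\ge2$, every $p$ with $$2R\le p<\infty,\qquad p\ge c\,\frac{R^2}{\log R},$$ every $n\in\mathbb N$, and every polynomial $F=\sum_{r=0}^RF_r:\mathbb C^n\to\mathbb C$ with $F_r$ $r$-homogeneous, one has $$\left(\sum_{r=1}^R\frac{|F_r|_{q(r,p)}^2}{r^{2B}}\right)^{1/2}\le C_{B,c}\,\|F\|_p,\qquad \|F\|_p:=\sup_{\|z\|_p\le1}|F(z)|.$$
   Context: For an $r$-homogeneous polynomial $P(z)=\sum_{|\alpha|=r}a_\alpha z^\alpha$ on $\mathbb C^n$ and $1\le s<\infty$, $|P|_s=(\sum_\alpha|a_\alpha|^s)^{1/s}$. Here $\|z\|_p=(\sum_{j}|z_j|^p)^{1/p}$ for $z\in\mathbb C^n$, $1\le p<\infty$. For $2r\le p<\infty$, $q(r,p)=\frac{2rp}{rp+p-2r}$. The constant $\beta_\ast<2.47$ is the threshold of the weighted graded Bohnenblust--Hille estimate (Pellegrino--Teixeira, 2026): it is a fixed real number with the property that, for every $b>\beta_\ast$, there is $K_b<\infty$ such that for every $R\ge1$, every $n\in\mathbb N$ and every analytic polynomial $G=\sum_{r=0}^RG_r$ on $\mathbb C^n$, with $G_r$ $r$-homogeneous, $$\left(\sum_{r=1}^R\frac{|G_r|_{q_r^0}^2}{r^{2b}}\right)^{1/2}\le K_b\,\|G\|_\infty,\qquad q_r^0:=\frac{2r}{r+1},$$ where $\|G\|_\infty$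 is the supremum of $|G|$ on the unit polydisc $\{z\in\mathbb C^n:\max_j|z_j|\le1\}$. This property of $\beta_\ast$ may be assumed. *)

theory Defs
  imports Complex_Main "HOL-Library.Poly_Mapping"
begin

text \<open>
  The dimension \<open>n\<close> is quantified inside the estimates, since the constants must not depend
  on it. A polynomial on \<open>\<complex>\<^sup>n\<close> is therefore a finitely supported map from exponent vectors to
  coefficients in which only the variables \<open>0, \<dots>, n - 1\<close> occur, and a point of \<open>\<complex>\<^sup>n\<close> is a
  function \<open>nat \<Rightarrow> complex\<close> whose values at indices \<open>\<ge> n\<close> are irrelevant.
\<close>

type_synonym cpoly = "(nat \<Rightarrow>\<^sub>0 nat) \<Rightarrow>\<^sub>0 complex"

definition total_degree :: "(nat \<Rightarrow>\<^sub>0 nat) \<Rightarrow> nat" where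
  "total_degree \<alpha> = (\<Sum>j\<in>Poly_Mapping.keys \<alpha>. Poly_Mapping.lookup \<alpha> j)"

definition peval :: "cpoly \<Rightarrow> (nat \<Rightarrow> complex) \<Rightarrow> complex" where
  "peval P z = (\<Sum>\<alpha>\<in>Poly_Mapping.keys P.
     Poly_Mapping.lookup P \<alpha> * (\<Prod>j\<in>Poly_Mapping.keys \<alpha>. z j ^ Poly_Mapping.lookup \<alpha> j))"

text \<open>The zero polynomial is homogeneous of every degree.\<close>

definition homogeneous_on :: "nat \<Rightarrow> nat \<Rightarrow> cpoly \<Rightarrow> bool" where
  "homogeneous_on n r P \<longleftrightarrow>
     (\<forall>\<alpha>\<in>Poly_Mapping.keys P. Poly_Mapping.keys \<alpha> \<subseteq> {..<n} \<and> total_degree \<alpha> = r)"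

definition coeff_norm :: "real \<Rightarrow> cpoly \<Rightarrow> real" where
  "coeff_norm s P = (\<Sum>\<alpha>\<in>Poly_Mapping.keys P. norm (Poly_Mapping.lookup P \<alpha>) powr s) powr (1 / s)"

definition lp_norm :: "nat \<Rightarrow> real \<Rightarrow> (nat \<Rightarrow> complex) \<Rightarrow> real" where
  "lp_norm n p z = (\<Sum>j<n. norm (z j) powr p) powr (1 / p)"

text \<open>
  For a polynomial in the first \<open>n\<close> variables and \<open>p \<ge> 1\<close>, the suprema below range over
  nonempty bounded sets, so the real-valued \<open>SUP\<close> is the genuine supremum.
\<close>

definition sup_norm_lp_ball :: "nat \<Rightarrow> real \<Rightarrow> cpoly \<Rightarrow> real" where
  "sup_norm_lp_ball n p P = (SUP z\<in>{z. lp_norm n p z \<le> 1}. norm (peval P z))"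

definition sup_norm_polydisc :: "nat \<Rightarrow> cpoly \<Rightarrow> real" where
  "sup_norm_polydisc n P = (SUP z\<in>{z. \<forall>j<n. norm (z j) \<le> 1}. norm (peval P z))"

definition q_exp :: "nat \<Rightarrow> real \<Rightarrow> real" where
  "q_exp r p = 2 * real r * p / (real r * p + p - 2 * real r)"

definition q0_exp :: "nat \<Rightarrow> real" where
  "q0_exp r = 2 * real r / (real r + 1)"

text \<open>
  The defining property of the threshold \<open>\<beta>\<^sub>*\<close> of the weighted graded Bohnenblust--Hille
  estimate (Pellegrino--Teixeira); the constant \<open>K\<close> depends on \<open>b\<close> only.
\<close>

definition weighted_graded_BH :: "real \<Rightarrow> bool" where
  "weighted_graded_BH \<beta> \<longleftrightarrow>
     (\<forall>b>\<beta>. \<exists>K::real. \<forall>R\<ge>1. \<forall>n. \<forall>G :: nat \<Rightarrow> cpoly.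
        (\<forall>r\<le>R. homogeneous_on n r (G r)) \<longrightarrow>
        sqrt (\<Sum>r=1..R. (coeff_norm (q0_exp r) (G r))\<^sup>2 / real r powr (2 * b))
          \<le> K * sup_norm_polydisc n (\<Sum>r\<le>R. G r))"

end

theory Submission
  imports Defs
    "HOL-Complex_Analysis.Complex_Analysis"
    "HOL-Computational_Algebra.Fundamental_Theorem_Algebra"
begin

text \<open>
Fix \<open>F = \<Sum> F\<^sub>r\<close> with coefficients \<open>a\<^sub>\<alpha>\<close> and put \<open>M = \<parallel>F\<parallel>\<^sub>p\<close>. If the nonnegative weights \<open>\<rho>\<^sub>j\<close> have
sum at most 1 and \<open>w\<^sub>j = \<rho>\<^sub>j\<^sup>1\<^sup>/\<^sup>p\<close>, then \<open>z \<mapsto> w z\<close> maps the polydisc into the unit ball of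
\<open>\<ell>\<^sub>p\<close>, so \<open>G(z) = F(w z)\<close> is bounded by \<open>M\<close> on the polydisc and the graded Bohnenblust--Hille
inequality applies to it. By itself this is too weak for every choice of \<open>\<rho>\<close>, as
\<open>z\<^sub>1\<^sup>r + \<dots> + z\<^sub>n\<^sup>r\<close> shows, because passing from \<open>a\<^sub>\<alpha> w\<^sup>\<alpha>\<close> back to \<open>a\<^sub>\<alpha>\<close> is expensive. It is
combined with a second inequality for \<open>G\<^sub>r\<close>, the mixed estimate
\<open>\<Sum>\<^sub>j (\<Sum>\<^sub>\<alpha> \<alpha>\<^sub>j\<^sup>2 |b\<^sub>\<alpha>|\<^sup>2)\<^sup>1\<^sup>/\<^sup>2 \<le> e r 2\<^sup>r\<^sup>/\<^sup>2 M\<close> for the coefficients \<open>b\<^sub>\<alpha>\<close> of \<open>G\<^sub>r\<close>.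

The mixed estimate (lemma \<open>mixed_norm_le\<close>) is a Cauchy estimate for the directional derivatives
of \<open>G\<^sub>r\<close>, followed by the comparison of the \<open>L\<^sup>1\<close> and the \<open>L\<^sup>2\<close> norm on the torus, which costs a
factor \<open>\<surd>2\<close> per degree. In one variable this comparison
(lemma \<open>damped_norm_le_circle_mean\<close>) says that the \<open>L\<^sup>2\<close> norm on the circle of radius \<open>1/\<surd>2\<close> is
at most the \<open>L\<^sup>1\<close> norm on the unit circle: after reflecting the zeros out of the disc the
polynomial is a square \<open>h\<^sup>2\<close>, and Cauchy--Schwarz for the coefficients of \<open>h\<^sup>2\<close> with
\<open>k + 1 \<le> 2\<^sup>k\<close> suffices. Minkowski's inequality carries it to several variables
(lemma \<open>torus_mean_lower_bound\<close>).

The two inequalities are joined by a choice of \<open>\<rho>\<close> adapted to the coefficients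
(lemma \<open>marginal_weights\<close>). Let \<open>\<mu>\<close> be the probability distribution on multi-indices proportional
to \<open>|a\<^sub>\<alpha>|\<^sup>q\<close>, and let \<open>\<rho>\<^sub>j\<close> be the \<open>\<mu>\<close>-mean of \<open>\<alpha>\<^sub>j/r\<close>. With \<open>s = 2r/(r+1)\<close> and \<open>\<theta> = 2r/p\<close>, so
that \<open>1/q = (1 - \<theta>)/s + \<theta>/2\<close>, Jensen's inequality bounds the \<open>s\<close>-norm and the mixed norm of
\<open>a\<^sub>\<alpha> w\<^sup>\<alpha>\<close> from below by \<open>|F\<^sub>r|\<^sub>q\<close> times exponentials of entropies of \<open>\<mu>\<close> and \<open>\<rho>\<close>; in the product
of the powers \<open>1 - \<theta>\<close> and \<open>\<theta>\<close> the entropies cancel. Hence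
\<open>|F\<^sub>r|\<^sub>q \<le> |G\<^sub>r|\<^sub>s\<^sup>1\<^sup>-\<^sup>\<theta> (e r 2\<^sup>r\<^sup>/\<^sup>2 M)\<^sup>\<theta>\<close>, and the factor
\<open>(2\<^sup>r\<^sup>/\<^sup>2)\<^sup>\<theta>\<close>, which is 2 to the power \<open>r\<^sup>2/p\<close>, is what the term \<open>log 2 / c\<close> in the exponent pays for.

These weights depend on \<open>r\<close>. Their average over \<open>1 \<le> r \<le> R\<close> serves all degrees at the cost of a
factor \<open>R\<^sup>r\<^sup>/\<^sup>p\<close> (lemma \<open>common_weight\<close>), which is bounded because \<open>R log R / p\<close> is. So the
Bohnenblust--Hille inequality is applied once, to a single \<open>G\<close>. Finally
\<open>x\<^sup>1\<^sup>-\<^sup>\<theta> M\<^sup>2\<^sup>\<theta> \<le> x + \<theta> M\<^sup>2\<close>: the first terms are summed by Bohnenblust--Hille, and the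
second ones because \<open>\<Sum> (2r/p) r\<^sup>-\<^sup>2\<^sup>\<delta>\<close> is bounded for every \<open>\<delta> > 0\<close>
(lemma \<open>sum_interpolation_parameters_le\<close>).
\<close>

section \<open>Means over roots of unity\<close>

text \<open>
The average over the \<open>N\<close>-th roots of unity stands in for the integral over the circle. In several
variables all means are then finite sums, and only \<open>N \<rightarrow> \<infinity>\<close> remains to be taken at the end.
\<close>

definition circle_mean :: "nat \<Rightarrow> (complex \<Rightarrow> 'a) \<Rightarrow> 'a::real_normed_field" where
  "circle_mean N f = (\<Sum>k<N. f (cis (2 * pi * real k / real N))) / of_nat N"

lemma circle_mean_mono:
  fixes f g :: "complex \<Rightarrow> real"
  assumes "\<And>z. norm z = 1 \<Longrightarrow> f z \<le> g z"
  shows "circle_mean N f \<le> circle_mean N g"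
  unfolding circle_mean_def by (intro divide_right_mono sum_mono assms) auto

lemma circle_mean_cong:
  assumes "\<And>z. norm z = 1 \<Longrightarrow> f z = g z"
  shows "circle_mean N f = circle_mean N g"
  unfolding circle_mean_def by (intro arg_cong2[where f="(/)"] sum.cong assms) auto

lemma circle_mean_sum:
  "circle_mean N (\<lambda>z. \<Sum>i\<in>I. f i z) = (\<Sum>i\<in>I. circle_mean N (f i))"
  unfolding circle_mean_def sum_divide_distrib by (subst sum.swap) simp

lemma circle_mean_mult: "circle_mean N (\<lambda>z. c * f z) = c * circle_mean N f"
  unfolding circle_mean_def by (simp add: sum_distrib_left)

lemma circle_mean_add: "circle_mean N (\<lambda>z. f z + g z) = circle_mean N f + circle_mean N g"
  unfolding circle_mean_def by (simp add: sum.distrib add_divide_distrib)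

lemma circle_mean_const: "N > 0 \<Longrightarrow> circle_mean N (\<lambda>z. c) = c"
  unfolding circle_mean_def by simp

lemma norm_circle_mean_le:
  assumes "\<And>z. norm z = 1 \<Longrightarrow> norm (f z) \<le> M" and "N > 0"
  shows "norm (circle_mean N f) \<le> M"
proof -
  have "norm (\<Sum>k<N. f (cis (2 * pi * real k / real N))) \<le> (\<Sum>k<N. M)"
    by (intro order_trans[OF norm_sum] sum_mono assms) auto
  thus ?thesis using assms(2) unfolding circle_mean_def
    by (simp add: norm_divide field_simps)
qed

lemma of_real_circle_mean:
  "of_real (circle_mean N f) = circle_mean N (\<lambda>z. of_real (f z) :: complex)"
  unfolding circle_mean_def by simp

lemma circle_mean_orthogonal:
  assumes "i < N" "j < N"
  shows "circle_mean N (\<lambda>z. z ^ i * cnj (z ^ j)) = (if i = j then 1 else 0)"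
proof -
  define \<omega> where "\<omega> = (\<lambda>k. cis (2 * pi * real k / real N))"
  have N: "N > 0" using assms by simp
  define u where "u = \<omega> i * cnj (\<omega> j)"
  have pow: "(\<omega> k) ^ l = (\<omega> l) ^ k" for k l
    unfolding \<omega>_def Complex.DeMoivre by (intro arg_cong[where f=cis]) simp
  have "u ^ N = 1"
    using N by (simp add: u_def \<omega>_def power_mult_distrib Complex.DeMoivre flip: complex_cnj_power)
  have *: "(\<omega> k) ^ i * cnj ((\<omega> k) ^ j) = u ^ k" for k
    by (simp add: pow[of k] u_def power_mult_distrib)
  have "circle_mean N (\<lambda>z. z ^ i * cnj (z ^ j)) = (\<Sum>k<N. u ^ k) / of_nat N"
    unfolding circle_mean_def \<omega>_def[symmetric] using *
    by (simp add: \<omega>_def)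
  also have "\<dots> = (if i = j then 1 else 0)"
  proof (cases "i = j")
    case True
    hence "u = 1" by (simp add: u_def \<omega>_def cis_cnj cis_mult)
    thus ?thesis using True N by simp
  next
    case False
    have "\<omega> i \<noteq> \<omega> j"
      using Complex.bij_betw_roots_unity[OF N] assms False unfolding \<omega>_def bij_betw_def inj_on_def by auto
    moreover have "\<omega> i = u * \<omega> j" by (simp add: u_def \<omega>_def cis_cnj cis_mult)
    ultimately have "u \<noteq> 1" by auto
    thus ?thesis using False \<open>u ^ N = 1\<close> by (simp add: sum_gp_strict)
  qed
  finally show ?thesis .
qed

text \<open>
For \<open>N\<close> above the degree, Parseval's identity holds exactly for the discrete mean.
\<close>

lemma circle_mean_parseval:
  assumes "m < N"
  shows "circle_mean N (\<lambda>z. (norm (\<Sum>k\<le>m. a k * z ^ k))\<^sup>2) = (\<Sum>k\<le>m. (norm (a k))\<^sup>2)"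
proof -
  have "complex_of_real ((norm (\<Sum>k\<le>m. a k * z ^ k))\<^sup>2)
      = (\<Sum>i\<le>m. \<Sum>j\<le>m. (a i * cnj (a j)) * (z ^ i * cnj (z ^ j)))" for z
    unfolding complex_norm_square by (simp add: sum_product mult_ac)
  hence "of_real (circle_mean N (\<lambda>z. (norm (\<Sum>k\<le>m. a k * z ^ k))\<^sup>2))
      = (\<Sum>i\<le>m. \<Sum>j\<le>m. (a i * cnj (a j)) * circle_mean N (\<lambda>z. z ^ i * cnj (z ^ j)))"
    unfolding of_real_circle_mean by (simp only: circle_mean_sum circle_mean_mult)
  also have "\<dots> = (\<Sum>i\<le>m. \<Sum>j\<le>m. (if i = j then a i * cnj (a j) else 0))"
    using assms by (intro sum.cong refl) (simp add: circle_mean_orthogonal del: complex_cnj_power)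
  also have "\<dots> = (\<Sum>i\<le>m. a i * cnj (a i))" by simp
  also have "\<dots> = of_real (\<Sum>k\<le>m. (norm (a k))\<^sup>2)"
    by (simp only: of_real_sum complex_norm_square)
  finally show ?thesis by (simp only: of_real_eq_iff)
qed


section \<open>The L1-L2 comparison for polynomials in one variable\<close>

text \<open>
The \<open>L\<^sup>2\<close> norm on the circle of radius \<open>1/\<surd>2\<close>.
\<close>

definition damped_norm :: "complex poly \<Rightarrow> real" where
  "damped_norm f = sqrt (\<Sum>k\<le>degree f. (norm (coeff f k))\<^sup>2 / 2 ^ k)"

lemma damped_norm_extend:
  assumes "degree f \<le> m"
  shows "damped_norm f = sqrt (\<Sum>k\<le>m. (norm (coeff f k))\<^sup>2 / 2 ^ k)"
  unfolding damped_norm_def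
  by (rule arg_cong[where f=sqrt], rule sum.mono_neutral_left)
     (use assms in \<open>auto simp: coeff_eq_0\<close>)

lemma damped_norm_nonneg: "damped_norm f \<ge> 0"
  by (simp add: damped_norm_def sum_nonneg)

lemma poly_altdef_le:
  fixes f :: "complex poly"
  assumes "degree f \<le> m"
  shows "poly f z = (\<Sum>k\<le>m. coeff f k * z ^ k)"
  unfolding poly_altdef[of f]
  by (rule sum.mono_neutral_left) (use assms in \<open>auto simp: coeff_eq_0\<close>)

text \<open>
Parseval on the circle of radius \<open>1/\<surd>2\<close>, which lies in the disc where the two polynomials are
compared.
\<close>

lemma damped_norm_mono:
  assumes "\<And>z. norm z \<le> 1 \<Longrightarrow> norm (poly f z) \<le> norm (poly g z)"
  shows "damped_norm f \<le> damped_norm g"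
proof -
  define m where "m = max (degree f) (degree g)"
  define s where "s = 1 / sqrt 2"
  have s: "0 < s" "s \<le> 1" "(s ^ k)\<^sup>2 = 1 / 2 ^ k" for k
    by (auto simp: s_def power_divide simp flip: power_mult)
       (simp add: mult.commute[of k] power_mult)
  have *: "circle_mean (Suc m) (\<lambda>z. (norm (poly h (of_real s * z)))\<^sup>2) = (damped_norm h)\<^sup>2"
    if "degree h \<le> m" for h
  proof -
    have "circle_mean (Suc m) (\<lambda>z. (norm (poly h (of_real s * z)))\<^sup>2)
        = circle_mean (Suc m) (\<lambda>z. (norm (\<Sum>k\<le>m. (coeff h k * of_real s ^ k) * z ^ k))\<^sup>2)"
      by (simp add: poly_altdef_le[OF that] power_mult_distrib mult_ac)
    also have "\<dots> = (\<Sum>k\<le>m. (norm (coeff h k * of_real s ^ k))\<^sup>2)"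
      by (rule circle_mean_parseval) simp
    also have "\<dots> = (\<Sum>k\<le>m. (norm (coeff h k))\<^sup>2 / 2 ^ k)"
      using s(1) by (simp add: norm_mult norm_power power_mult_distrib s(3))
    also have "\<dots> = (damped_norm h)\<^sup>2"
      by (simp add: damped_norm_extend[OF that] sum_nonneg)
    finally show ?thesis .
  qed
  have "(damped_norm f)\<^sup>2 \<le> (damped_norm g)\<^sup>2"
    unfolding *[of f, symmetric, unfolded m_def, simplified, folded m_def]
      *[of g, symmetric, unfolded m_def, simplified, folded m_def]
    using s(1,2) by (intro circle_mean_mono power_mono assms) (auto simp: norm_mult)
  thus ?thesis using damped_norm_nonneg by (rule power2_le_imp_le)
qed

text \<open>
A factor \<open>z - a\<close> with \<open>|a| < 1\<close> is replaced by \<open>1 - cnj a z\<close>, which has the same modulus on the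
unit circle, dominates it inside, and has no zero in the disc. This is the removal of a Blaschke
product, done without raising the degree.
\<close>

lemma reflect_zeros:
  fixes f :: "complex poly"
  assumes "f \<noteq> 0"
  obtains g where "degree g \<le> degree f"
    "\<And>z. norm z = 1 \<Longrightarrow> norm (poly g z) = norm (poly f z)"
    "\<And>z. norm z \<le> 1 \<Longrightarrow> norm (poly f z) \<le> norm (poly g z)"
    "\<And>z. norm z < 1 \<Longrightarrow> poly g z \<noteq> 0"
proof -
  have "\<exists>g. degree g \<le> degree f \<and> (\<forall>z. norm z = 1 \<longrightarrow> norm (poly g z) = norm (poly f z))
      \<and> (\<forall>z. norm z \<le> 1 \<longrightarrow> norm (poly f z) \<le> norm (poly g z)) \<and> (\<forall>z. norm z < 1 \<longrightarrow> poly g z \<noteq> 0)"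
    using assms
  proof (induction "degree f" arbitrary: f)
    case 0
    then obtain c where "f = [:c:]" "c \<noteq> 0" by (metis degree_0_id of_nat_eq_0_iff pCons_0_0)
    thus ?case by (intro exI[of _ f]) auto
  next
    case (Suc d)
    then obtain a where "poly f a = 0"
      using alg_closed_imp_poly_has_root[of f] by auto
    then obtain f1 where f: "f = [:-a, 1:] * f1" by (auto simp: poly_eq_0_iff_dvd elim: dvdE)
    have f1: "f1 \<noteq> 0" "degree f1 = d"
      using Suc.prems Suc.hyps(2) by (auto simp: f degree_mult_eq simp del: mult_pCons_left)
    from Suc.hyps(1)[OF f1(2)[symmetric] f1(1)] obtain g1 where g1: "degree g1 \<le> degree f1"
      "\<And>z. norm z = 1 \<Longrightarrow> norm (poly g1 z) = norm (poly f1 z)"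
      "\<And>z. norm z \<le> 1 \<Longrightarrow> norm (poly f1 z) \<le> norm (poly g1 z)"
      "\<And>z. norm z < 1 \<Longrightarrow> poly g1 z \<noteq> 0" by blast
    define q where "q = (if norm a \<ge> 1 then [:-a, 1:] else [:1, - cnj a:])"
    have sq: "(norm (1 - cnj a * z))\<^sup>2 - (norm (z - a))\<^sup>2 = (1 - (norm a)\<^sup>2) * (1 - (norm z)\<^sup>2)" for z
      unfolding cmod_power2 by (simp add: power2_eq_square algebra_simps)
    have q1: "norm (poly q z) = norm (z - a)" if "norm z = 1" for z
    proof (cases "norm a \<ge> 1")
      case False
      have "(norm (1 - cnj a * z))\<^sup>2 = (norm (z - a))\<^sup>2" using sq[of z] that by simp
      hence "norm (1 - cnj a * z) = norm (z - a)" by simp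
      thus ?thesis using False by (simp add: q_def mult.commute)
    qed (simp add: q_def)
    have q2: "norm (z - a) \<le> norm (poly q z)" if "norm z \<le> 1" for z
    proof (cases "norm a \<ge> 1")
      case False
      have "(1 - (norm a)\<^sup>2) * (1 - (norm z)\<^sup>2) \<ge> 0"
        using False that by (intro mult_nonneg_nonneg) (auto simp: power_le_one)
      hence "(norm (z - a))\<^sup>2 \<le> (norm (1 - cnj a * z))\<^sup>2" using sq[of z] by linarith
      hence "norm (z - a) \<le> norm (1 - cnj a * z)" by (rule power2_le_imp_le) simp
      thus ?thesis using False by (simp add: q_def mult.commute)
    qed (simp add: q_def)
    have q3: "poly q z \<noteq> 0" if "norm z < 1" for z
    proof (cases "norm a \<ge> 1")
      case False
      have "norm (cnj a * z) < 1"
        using mult_left_le_one_le[of "norm z" "norm a"] False that by (simp add: norm_mult)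
      hence "cnj a * z \<noteq> 1" by auto
      thus ?thesis using False by (auto simp: q_def mult.commute)
    qed (use that in \<open>auto simp: q_def\<close>)
    have "degree q \<le> 1" by (simp add: q_def)
    show ?case
    proof (intro exI[of _ "q * g1"] conjI allI impI)
      show "degree (q * g1) \<le> degree f"
        using degree_mult_le[of q g1] \<open>degree q \<le> 1\<close> g1(1) f1(2) Suc.hyps(2) by linarith
      show "norm (poly (q * g1) z) = norm (poly f z)" if "norm z = 1" for z
        using q1[OF that] g1(2)[OF that] by (simp add: f norm_mult del: mult_pCons_left)
      show "norm (poly f z) \<le> norm (poly (q * g1) z)" if "norm z \<le> 1" for z
        using mult_mono[OF q2[OF that] g1(3)[OF that]] by (simp add: f norm_mult del: mult_pCons_left)
      show "poly (q * g1) z \<noteq> 0" if "norm z < 1" for z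
        using q3[OF that] g1(4)[OF that] by simp
    qed
  qed
  thus ?thesis using that by blast
qed

text \<open>
Every \<open>N l\<close>-th root of unity is within \<open>2 \<pi> / N\<close> of an \<open>N\<close>-th one. So an inequality that is known
for all sufficiently fine means passes to the mean over \<open>N\<close> points with an explicit error, and
this \<open>N\<close> need not depend on the function beyond its Lipschitz constant.
\<close>

lemma circle_mean_refine:
  fixes \<phi> :: "complex \<Rightarrow> real"
  assumes "\<And>z w. norm z = 1 \<Longrightarrow> norm w = 1 \<Longrightarrow> \<bar>\<phi> z - \<phi> w\<bar> \<le> L * norm (z - w)"
    and "L \<ge> 0" "N > 0" "l > 0"
  shows "circle_mean (N * l) \<phi> \<le> circle_mean N \<phi> + 2 * pi / N * L"
proof -
  \<comment> \<open>the \<open>N l\<close> points come in \<open>N\<close> blocks of \<open>l\<close>, the \<open>i\<close>-th of which starts at the \<open>i\<close>-th coarse point\<close>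
  let ?c = "\<lambda>k. cis (2 * pi * real k / real (N * l))"
  let ?d = "\<lambda>i. cis (2 * pi * real i / real N)"
  have step: "\<phi> (?c k) \<le> \<phi> (?d i) + 2 * pi / N * L" if "k \<in> {i*l..<i*l+l}" for i k
  proof -
    define j where "j = k - i * l"
    have k: "k = i * l + j" "j < l" using that by (auto simp: j_def)
    have "norm (?c k - ?d i) \<le> \<bar>2 * pi * real k / real (N * l) - 2 * pi * real i / real N\<bar>"
    proof -
      have "cis x - cis y = cis y * (cis (x - y) - 1)" for x y
        by (simp add: algebra_simps cis_mult)
      hence "norm (cis x - cis y) = norm (cis (x - y) - 1)" for x y
        by (simp add: norm_mult)
      moreover have "norm (cis t - 1) \<le> \<bar>t\<bar>" for t
      proof -
        have "dist (cis t) (cis 0) \<le> \<bar>t - 0\<bar>"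
          using dist_exp_i_1[of t] abs_sin_x_le_abs_x[of "t/2"]
          by (simp add: dist_norm cis_conv_exp)
        thus ?thesis by (simp add: dist_norm)
      qed
      ultimately show ?thesis by simp
    qed
    also have "\<dots> = 2 * pi / N * (j / l)"
      using assms(3,4) by (simp add: k field_simps)
    also have "\<dots> \<le> 2 * pi / N * 1" using k(2) by (intro mult_left_mono) auto
    finally have "norm (?c k - ?d i) \<le> 2 * pi / N" by simp
    hence "L * norm (?c k - ?d i) \<le> L * (2 * pi / N)" using assms(2) by (rule mult_left_mono)
    moreover have "\<bar>\<phi> (?c k) - \<phi> (?d i)\<bar> \<le> L * norm (?c k - ?d i)" by (rule assms(1)) auto
    ultimately show ?thesis by (simp add: mult.commute)
  qed
  have "(\<Sum>k<N*l. \<phi> (?c k)) = (\<Sum>i<N. \<Sum>k\<in>{i*l..<i*l+l}. \<phi> (?c k))"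
    by (simp add: sum.nat_group)
  also have "\<dots> \<le> (\<Sum>i<N. \<Sum>k\<in>{i*l..<i*l+l}. \<phi> (?d i) + 2 * pi / N * L)"
    by (intro sum_mono step)
  also have "\<dots> = l * (\<Sum>i<N. \<phi> (?d i)) + l * N * (2 * pi / N * L)"
    by (simp add: sum.distrib sum_distrib_left algebra_simps)
  finally have "(\<Sum>k<N*l. \<phi> (?c k)) / (N * l)
      \<le> (l * (\<Sum>i<N. \<phi> (?d i)) + l * N * (2 * pi / N * L)) / (N * l)"
    by (rule divide_right_mono) simp
  also have "\<dots> = (\<Sum>i<N. \<phi> (?d i)) / N + 2 * pi / N * L"
    using assms(3,4) by (simp add: field_simps)
  finally show ?thesis by (simp add: circle_mean_def)
qed

lemma holomorphic_square_root_power_series: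
  fixes g :: "complex poly"
  assumes "s > 0" and nz: "\<And>z. norm z < s \<Longrightarrow> poly g z \<noteq> 0"
  obtains c where "\<And>k. coeff g k = (\<Sum>i\<le>k. c i * c (k - i))"
    and "\<And>z. norm z < s \<Longrightarrow> summable (\<lambda>k. c k * z ^ k)"
    and "\<And>z. norm z < s \<Longrightarrow> (suminf (\<lambda>k. c k * z ^ k))\<^sup>2 = poly g z"
proof -
  obtain h where h: "h holomorphic_on ball 0 s" "\<And>z. z \<in> ball 0 s \<Longrightarrow> poly g z = (h z)\<^sup>2"
    by (rule contractible_imp_holomorphic_sqrt[of "poly g" "ball 0 s"])
       (use nz in \<open>auto intro!: holomorphic_intros convex_imp_contractible\<close>)
  define c where "c = (\<lambda>k. (deriv ^^ k) h 0 / fact k)"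
  have sums: "(\<lambda>k. c k * z ^ k) sums h z" if "norm z < s" for z
    using holomorphic_power_series[OF h(1), of z] that by (simp add: c_def)
  define H where "H = fps_expansion h 0"
  have H: "h has_fps_expansion H"
    unfolding H_def using h(1) assms(1) by (intro has_fps_expansion_fps_expansion[of "ball 0 s"]) auto
  have "(\<lambda>z. h z * h z) has_fps_expansion H * H" by (intro has_fps_expansion_mult H)
  moreover have "(\<lambda>z. h z * h z) has_fps_expansion fps_of_poly g"
    unfolding has_fps_expansion_def
  proof
    show "eventually (\<lambda>z. eval_fps (fps_of_poly g) z = h z * h z) (nhds 0)"
    proof (rule eventually_mono)
      show "eventually (\<lambda>z. z \<in> ball 0 s) (nhds 0)"
        using assms(1) by (intro eventually_nhds_in_open) auto
      show "eval_fps (fps_of_poly g) z = h z * h z" if "z \<in> ball 0 s" for z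
        using h(2)[OF that] by (simp add: power2_eq_square)
    qed
  qed simp
  ultimately have "H * H = fps_of_poly g" by (rule fps_expansion_unique_complex)
  hence "coeff g k = fps_nth (H * H) k" for k by simp
  hence conv: "coeff g k = (\<Sum>i\<le>k. c i * c (k - i))" for k
    by (simp add: fps_mult_nth H_def fps_expansion_def c_def atMost_atLeast0)
  have square: "(suminf (\<lambda>k. c k * z ^ k))\<^sup>2 = poly g z" if "norm z < s" for z
    using sums_unique[OF sums[OF that]] h(2)[of z] that by simp
  show ?thesis by (rule that[OF conv sums_summable[OF sums] square])
qed

lemma sum_convolution_le:
  fixes f :: "nat \<Rightarrow> real"
  assumes "\<And>k. f k \<ge> 0"
  shows "(\<Sum>k\<le>d. \<Sum>i\<le>k. f i * f (k - i)) \<le> (\<Sum>k\<le>d. f k)\<^sup>2"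
proof -
  have "(\<Sum>k\<le>d. \<Sum>i\<le>k. f i * f (k - i)) = (\<Sum>(i,j)\<in>{(i,j). i+j \<le> d}. f i * f j)"
    using sum.triangle_reindex_eq[of "\<lambda>i j. f i * f j" d] by simp
  also have "\<dots> \<le> (\<Sum>(i,j)\<in>{..d}\<times>{..d}. f i * f j)"
    by (intro sum_mono2) (auto simp: assms)
  also have "\<dots> = (\<Sum>k\<le>d. f k)\<^sup>2"
    by (simp add: power2_eq_square sum_product sum.cartesian_product)
  finally show ?thesis .
qed

text \<open>
Write \<open>g = h\<^sup>2\<close> with \<open>h\<close> holomorphic beyond the unit disc. The square of the \<open>L\<^sup>2\<close> norm of \<open>h\<close> is
the \<open>L\<^sup>1\<close> norm of \<open>g\<close>, and by Parseval it bounds \<open>\<Sum> |c\<^sub>k|\<^sup>2\<close> for the Taylor coefficients of \<open>h\<close>;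
Parseval is applied to a Taylor polynomial that is uniformly close to \<open>h\<close>. The coefficients of
\<open>g\<close> are convolutions of the \<open>c\<^sub>k\<close>.
\<close>

lemma damped_norm_le_eventually:
  fixes g :: "complex poly"
  assumes "s > 1" and nz: "\<And>z. norm z < s \<Longrightarrow> poly g z \<noteq> 0" and "\<epsilon> > 0"
  shows "\<exists>M. \<forall>N>M. damped_norm g \<le> circle_mean N (\<lambda>z. norm (poly g z)) + \<epsilon>"
proof -
  from assms(1) have "s > 0" by simp
  from holomorphic_square_root_power_series[OF this nz] obtain c where
    c: "\<And>k. coeff g k = (\<Sum>i\<le>k. c i * c (k - i))"
       "\<And>z. norm z < s \<Longrightarrow> summable (\<lambda>k. c k * z ^ k)"
       "\<And>z. norm z < s \<Longrightarrow> (suminf (\<lambda>k. c k * z ^ k))\<^sup>2 = poly g z" by blast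
  define h where "h = (\<lambda>z. suminf (\<lambda>k. c k * z ^ k))"
  have summ: "summable (\<lambda>k. norm (c k))"
  proof -
    \<comment> \<open>absolute convergence on the unit circle comes from convergence at a point outside it\<close>
    obtain t where t: "1 < t" "t < s" using assms(1) dense by blast
    hence "summable (\<lambda>k. c k * of_real t ^ k)" by (intro c(2)) simp
    from powser_insidea[OF this, of 1] show ?thesis using t by simp
  qed
  define S where "S = suminf (\<lambda>k. norm (c k))"
  define T where "T = (\<lambda>M. suminf (\<lambda>k. norm (c (k + M))))"
  have "T \<longlonglongrightarrow> 0"
    unfolding T_def using suminf_exist_split2[OF summ] by simp
  hence "(\<lambda>M. T (Suc M) * (2 * S)) \<longlonglongrightarrow> 0"
    using LIMSEQ_Suc tendsto_mult_left_zero by blast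
  hence "eventually (\<lambda>M. T (Suc M) * (2 * S) < \<epsilon>) sequentially"
    using assms(3) by (rule order_tendstoD)
  then obtain M0 where M0: "\<And>M. M \<ge> M0 \<Longrightarrow> T (Suc M) * (2 * S) < \<epsilon>"
    by (auto simp: eventually_sequentially)
  define M where "M = max M0 (degree g)"
  define P where "P = (\<lambda>z. \<Sum>k\<le>M. c k * z ^ k)"
  have P_le: "(norm (P z))\<^sup>2 \<le> norm (poly g z) + \<epsilon>" if z: "norm z = 1" for z
  proof -
    have sn: "summable (\<lambda>k. norm (c k * z ^ k))" using summ z by (simp add: norm_mult norm_power)
    have "h z = suminf (\<lambda>k. c (k + Suc M) * z ^ (k + Suc M)) + P z"
      unfolding h_def P_def lessThan_Suc_atMost[symmetric]
      by (rule suminf_split_initial_segment[OF summable_norm_cancel[OF sn]])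
    hence "norm (P z - h z) = norm (suminf (\<lambda>k. c (k + Suc M) * z ^ (k + Suc M)))" by simp
    also have "\<dots> \<le> suminf (\<lambda>k. norm (c (k + Suc M) * z ^ (k + Suc M)))"
      using sn by (intro summable_norm summable_ignore_initial_segment[OF sn, of "Suc M"])
    also have "\<dots> = T (Suc M)" using z by (simp add: T_def norm_mult norm_power)
    finally have 1: "norm (P z - h z) \<le> T (Suc M)" .
    have 2: "norm (h z) \<le> S"
      unfolding h_def S_def using summable_norm[OF sn] z by (simp add: norm_mult norm_power)
    have 3: "norm (P z) \<le> S"
    proof -
      have "norm (P z) \<le> (\<Sum>k\<le>M. norm (c k))"
        unfolding P_def using z by (intro order_trans[OF norm_sum]) (simp add: norm_mult norm_power)
      also have "\<dots> \<le> S" unfolding S_def by (rule sum_le_suminf[OF summ]) auto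
      finally show ?thesis .
    qed
    have "(norm (P z))\<^sup>2 - (norm (h z))\<^sup>2 = (norm (P z) - norm (h z)) * (norm (P z) + norm (h z))"
      by (simp add: power2_eq_square algebra_simps)
    also have "\<dots> \<le> T (Suc M) * (2 * S)"
    proof (rule mult_mono)
      show "norm (P z) - norm (h z) \<le> T (Suc M)" using 1 norm_triangle_ineq2[of "P z" "h z"] by linarith
      show "T (Suc M) \<ge> 0" using 1 norm_ge_zero order_trans by blast
    qed (use 2 3 in auto)
    also have "\<dots> \<le> \<epsilon>" using M0[of M] by (simp add: M_def)
    finally have "(norm (P z))\<^sup>2 \<le> norm ((h z)\<^sup>2) + \<epsilon>" by (simp add: norm_power)
    also have "(h z)\<^sup>2 = poly g z" unfolding h_def using z assms(1) by (intro c(3)) simp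
    finally show ?thesis .
  qed
  show ?thesis
  proof (intro exI[of _ M] allI impI)
    fix N assume N: "N > M"
    let ?d = "degree g"
    \<comment> \<open>a coefficient of \<open>h\<^sup>2\<close> has \<open>k + 1\<close> summands; Cauchy--Schwarz costs this number, and it is at most \<open>2 ^ k\<close>\<close>
    have "(damped_norm g)\<^sup>2 = (\<Sum>k\<le>?d. (norm (coeff g k))\<^sup>2 / 2 ^ k)"
      by (simp add: damped_norm_def sum_nonneg)
    also have "\<dots> \<le> (\<Sum>k\<le>?d. \<Sum>i\<le>k. (norm (c i))\<^sup>2 * (norm (c (k - i)))\<^sup>2)"
    proof (rule sum_mono)
      fix k
      have "norm (coeff g k) \<le> (\<Sum>i\<le>k. norm (c i) * norm (c (k - i)))"
        unfolding c(1) by (intro order_trans[OF norm_sum]) (simp add: norm_mult)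
      hence "(norm (coeff g k))\<^sup>2 \<le> (\<Sum>i\<le>k. 1 * (norm (c i) * norm (c (k - i))))\<^sup>2"
        by (simp add: power_mono)
      also have "\<dots> \<le> (\<Sum>i\<le>k. 1\<^sup>2) * (\<Sum>i\<le>k. (norm (c i) * norm (c (k - i)))\<^sup>2)"
        by (rule Cauchy_Schwarz_ineq_sum)
      also have "\<dots> = (1 + k) * (\<Sum>i\<le>k. (norm (c i))\<^sup>2 * (norm (c (k - i)))\<^sup>2)"
        by (simp add: power_mult_distrib)
      also have "\<dots> \<le> 2 ^ k * (\<Sum>i\<le>k. (norm (c i))\<^sup>2 * (norm (c (k - i)))\<^sup>2)"
      proof (intro mult_right_mono sum_nonneg)
        have "1 + k \<le> (2::nat) ^ k" using less_exp[of k] by (simp add: Suc_le_eq)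
        thus "real (1 + k) \<le> 2 ^ k" using of_nat_mono[of "1 + k" "2 ^ k", where 'a = real] by simp
      qed auto
      finally show "(norm (coeff g k))\<^sup>2 / 2 ^ k \<le> (\<Sum>i\<le>k. (norm (c i))\<^sup>2 * (norm (c (k - i)))\<^sup>2)"
        by (simp add: field_simps)
    qed
    also have "\<dots> \<le> (\<Sum>k\<le>?d. (norm (c k))\<^sup>2)\<^sup>2" by (rule sum_convolution_le) simp
    finally have "damped_norm g \<le> (\<Sum>k\<le>?d. (norm (c k))\<^sup>2)"
      by (rule power2_le_imp_le) (simp add: sum_nonneg)
    also have "\<dots> \<le> (\<Sum>k\<le>M. (norm (c k))\<^sup>2)" by (intro sum_mono2) (auto simp: M_def)
    also have "\<dots> = circle_mean N (\<lambda>z. (norm (P z))\<^sup>2)"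
      unfolding P_def by (rule circle_mean_parseval[symmetric, OF N])
    also have "\<dots> \<le> circle_mean N (\<lambda>z. norm (poly g z) + \<epsilon>)" by (rule circle_mean_mono[OF P_le])
    also have "\<dots> = circle_mean N (\<lambda>z. norm (poly g z)) + \<epsilon>"
      using N by (simp add: circle_mean_add circle_mean_const)
    finally show "damped_norm g \<le> circle_mean N (\<lambda>z. norm (poly g z)) + \<epsilon>" .
  qed
qed

lemma norm_poly_diff_le:
  fixes f :: "complex poly"
  assumes "norm z \<le> 1" "norm w \<le> 1"
  shows "\<bar>norm (poly f z) - norm (poly f w)\<bar> \<le> (\<Sum>k\<le>degree f. k * norm (coeff f k)) * norm (z - w)"
proof -
  have "\<bar>norm (poly f z) - norm (poly f w)\<bar> \<le> norm (poly f z - poly f w)" by (rule norm_triangle_ineq3)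
  also have "poly f z - poly f w = (\<Sum>k\<le>degree f. coeff f k * (z ^ k - w ^ k))"
    unfolding poly_altdef by (simp add: sum_subtractf algebra_simps)
  also have "norm \<dots> \<le> (\<Sum>k\<le>degree f. norm (coeff f k) * (k * norm (z - w)))"
    by (intro order_trans[OF norm_sum] sum_mono)
       (simp add: norm_mult mult_left_mono norm_power_diff[OF assms])
  also have "\<dots> = (\<Sum>k\<le>degree f. k * norm (coeff f k)) * norm (z - w)"
    by (subst sum_distrib_right) (simp add: mult_ac)
  finally show ?thesis .
qed

lemma damped_norm_le_zero_free:
  fixes g :: "complex poly"
  assumes "s > 1" and nz: "\<And>z. norm z < s \<Longrightarrow> poly g z \<noteq> 0" and N: "N > 0"
  shows "damped_norm g \<le> circle_mean N (\<lambda>z. norm (poly g z))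
    + 2 * pi / N * (\<Sum>k\<le>degree g. k * norm (coeff g k))"
proof (rule field_le_epsilon)
  fix \<epsilon> :: real assume "\<epsilon> > 0"
  then obtain M where M: "\<And>N'. N' > M \<Longrightarrow> damped_norm g \<le> circle_mean N' (\<lambda>z. norm (poly g z)) + \<epsilon>"
    using damped_norm_le_eventually[OF assms(1) nz] by blast
  have "N * Suc M > M" using N mult_le_mono1[of 1 N "Suc M"] by simp
  from M[OF this] have "damped_norm g \<le> circle_mean (N * Suc M) (\<lambda>z. norm (poly g z)) + \<epsilon>" .
  also have "circle_mean (N * Suc M) (\<lambda>z. norm (poly g z)) \<le> circle_mean N (\<lambda>z. norm (poly g z))
    + 2 * pi / N * (\<Sum>k\<le>degree g. k * norm (coeff g k))"
    using N by (intro circle_mean_refine norm_poly_diff_le) (auto intro!: sum_nonneg)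
  finally show "damped_norm g \<le> circle_mean N (\<lambda>z. norm (poly g z))
    + 2 * pi / N * (\<Sum>k\<le>degree g. k * norm (coeff g k)) + \<epsilon>" by simp
qed

lemma coeff_pcompose_dilation: "coeff (pcompose g [:0, s:]) k = coeff g k * (s::complex) ^ k"
proof (induction g arbitrary: k)
  case (pCons a g)
  show ?case by (cases k) (simp_all add: pcompose_pCons pCons.IH coeff_pCons mult_ac)
qed simp

text \<open>
Zeros on the unit circle prevent a holomorphic root on a larger disc. They are avoided by passing
to the dilations \<open>g (s z)\<close> with \<open>s < 1\<close> and letting \<open>s\<close> tend to 1.
\<close>

lemma damped_norm_le_zero_free_disc:
  fixes g :: "complex poly"
  assumes nz: "\<And>z. norm z < 1 \<Longrightarrow> poly g z \<noteq> 0" and N: "N > 0"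
  shows "damped_norm g \<le> circle_mean N (\<lambda>z. norm (poly g z))
    + 2 * pi / N * (\<Sum>k\<le>degree g. k * norm (coeff g k))"
proof -
  define d where "d = degree g"
  let ?L = "\<lambda>s. sqrt (\<Sum>k\<le>d. (norm (coeff g k) * s ^ k)\<^sup>2 / 2 ^ k)"
  let ?R = "\<lambda>s. circle_mean N (\<lambda>z. norm (poly g (of_real s * z)))
    + 2 * pi / N * (\<Sum>k\<le>d. k * (norm (coeff g k) * s ^ k))"
  have "?L s \<le> ?R s" if s: "0 < s" "s < 1" for s :: real
  proof -
    define gs where "gs = pcompose g [:0, of_real s:]"
    have deg: "degree gs = d" using s by (simp add: gs_def d_def degree_pcompose)
    have cf: "norm (coeff gs k) = norm (coeff g k) * s ^ k" for k
      using s by (simp add: gs_def coeff_pcompose_dilation norm_mult norm_power)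
    have "poly gs z \<noteq> 0" if "norm z < 1 / s" for z
      unfolding gs_def poly_pcompose using that s
      by (intro nz) (simp add: norm_mult field_simps)
    moreover have "1 / s > 1" using s by simp
    ultimately have "damped_norm gs \<le> circle_mean N (\<lambda>z. norm (poly gs z))
      + 2 * pi / N * (\<Sum>k\<le>degree gs. k * norm (coeff gs k))"
      using damped_norm_le_zero_free N by blast
    thus ?thesis
      by (simp add: damped_norm_def deg cf) (simp add: gs_def poly_pcompose mult.commute)
  qed
  hence ev: "eventually (\<lambda>s. ?L s \<le> ?R s) (at_left 1)"
    unfolding eventually_at_left_field by (intro exI[of _ 0]) auto
  have 1: "isCont ?L 1" by (intro continuous_intros) auto
  have 2: "isCont ?R 1" unfolding circle_mean_def by (intro continuous_intros) (use N in auto)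
  have 1: "(?L \<longlongrightarrow> ?L 1) (at_left 1)"
    using 1 unfolding isCont_def by (rule filterlim_mono[OF _ order_refl at_le]) auto
  have 2: "(?R \<longlongrightarrow> ?R 1) (at_left 1)"
    using 2 unfolding isCont_def by (rule filterlim_mono[OF _ order_refl at_le]) auto
  have "?L 1 \<le> ?R 1"
    by (rule tendsto_le[OF _ 2 1 ev]) simp
  thus ?thesis by (simp add: damped_norm_def d_def)
qed

text \<open>
The \<open>L\<^sup>1\<close>--\<open>L\<^sup>2\<close> comparison in one variable. The error of the discrete mean is absorbed in the factor
on the left, which is the same for all polynomials of degree at most \<open>m\<close>; this uniformity is what
makes the iteration over the variables possible.
\<close>

lemma damped_norm_le_circle_mean:
  fixes f :: "complex poly"
  assumes "degree f \<le> m" and N: "N > 0"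
  shows "(1 - 2 * pi * real m * real (Suc m) * 2 ^ m / N) * damped_norm f \<le> circle_mean N (\<lambda>z. norm (poly f z))"
proof (cases "f = 0 \<or> 2 * pi * real m * real (Suc m) * 2 ^ m / N > 1")
  case True
  have "circle_mean N (\<lambda>z. norm (poly f z)) \<ge> 0"
    by (simp add: circle_mean_def sum_nonneg)
  moreover have "(1 - 2 * pi * real m * real (Suc m) * 2 ^ m / N) * damped_norm f \<le> 0"
    using True damped_norm_nonneg[of f] by (auto simp: damped_norm_def mult_nonpos_nonneg)
  ultimately show ?thesis by linarith
next
  case False
  hence "f \<noteq> 0" by simp
  then obtain g where g: "degree g \<le> degree f"
    "\<And>z. norm z = 1 \<Longrightarrow> norm (poly g z) = norm (poly f z)"
    "\<And>z. norm z \<le> 1 \<Longrightarrow> norm (poly f z) \<le> norm (poly g z)"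
    "\<And>z. norm z < 1 \<Longrightarrow> poly g z \<noteq> 0" using reflect_zeros by blast
  \<comment> \<open>the Lipschitz constant of \<open>g\<close> is bounded by its damped norm, so that the error is relative\<close>
  have cf: "norm (coeff g k) \<le> 2 ^ m * damped_norm g" if "k \<le> degree g" for k
  proof -
    have "(norm (coeff g k))\<^sup>2 / 2 ^ k \<le> (damped_norm g)\<^sup>2"
      using that by (simp add: damped_norm_def sum_nonneg) (rule member_le_sum, auto)
    hence "(norm (coeff g k))\<^sup>2 \<le> 2 ^ k * (damped_norm g)\<^sup>2" by (simp add: field_simps)
    also have "\<dots> \<le> 2 ^ (2 * m) * (damped_norm g)\<^sup>2"
      using that g(1) assms(1) by (intro mult_right_mono power_increasing) auto
    also have "\<dots> = (2 ^ m * damped_norm g)\<^sup>2" by (simp add: power_mult_distrib power_even_eq)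
    finally show ?thesis by (rule power2_le_imp_le) (simp add: damped_norm_nonneg)
  qed
  have "(\<Sum>k\<le>degree g. k * norm (coeff g k)) \<le> (\<Sum>k\<le>degree g. real m * (2 ^ m * damped_norm g))"
    using g(1) assms(1) by (intro sum_mono mult_mono cf) auto
  also have "\<dots> = real (Suc (degree g)) * (real m * (2 ^ m * damped_norm g))" by simp
  also have "\<dots> \<le> real (Suc m) * (real m * (2 ^ m * damped_norm g))"
    using g(1) assms(1) by (intro mult_right_mono) (auto simp: damped_norm_nonneg)
  finally have sum_le: "(\<Sum>k\<le>degree g. k * norm (coeff g k)) \<le> real (Suc m) * (real m * (2 ^ m * damped_norm g))" .
  have "(1 - 2 * pi * real m * real (Suc m) * 2 ^ m / N) * damped_norm f
      \<le> (1 - 2 * pi * real m * real (Suc m) * 2 ^ m / N) * damped_norm g"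
    using False by (intro mult_left_mono damped_norm_mono g(3)) auto
  also have "\<dots> = damped_norm g - 2 * pi / N * (real (Suc m) * (real m * (2 ^ m * damped_norm g)))"
    by (simp add: algebra_simps add_divide_distrib)
  also have "\<dots> \<le> damped_norm g - 2 * pi / N * (\<Sum>k\<le>degree g. k * norm (coeff g k))"
    using sum_le by (intro diff_left_mono mult_left_mono) auto
  also have "\<dots> \<le> circle_mean N (\<lambda>z. norm (poly g z))"
    using damped_norm_le_zero_free_disc[OF g(4) N] by simp
  also have "\<dots> = circle_mean N (\<lambda>z. norm (poly f z))" by (rule circle_mean_cong[OF g(2)])
  finally show ?thesis .
qed

section \<open>The L1-L2 comparison on the torus\<close>

text \<open>
The iterated mean over the first \<open>n\<close> coordinates. The value 1 in the base case keeps the remaining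
coordinates on the unit circle.
\<close>

fun torus_mean :: "nat \<Rightarrow> nat \<Rightarrow> ((nat \<Rightarrow> complex) \<Rightarrow> real) \<Rightarrow> real" where
  "torus_mean N 0 f = f (\<lambda>_. 1)"
| "torus_mean N (Suc n) f = circle_mean N (\<lambda>t. torus_mean N n (\<lambda>z. f (z(n := t))))"

lemma torus_mean_sum:
  "torus_mean N n (\<lambda>z. \<Sum>i\<in>I. f i z) = (\<Sum>i\<in>I. torus_mean N n (f i))"
  by (induction n arbitrary: f) (simp_all add: circle_mean_sum)

lemma torus_mean_le:
  assumes "\<And>z. (\<And>j. norm (z j) = 1) \<Longrightarrow> f z \<le> M" and "N > 0"
  shows "torus_mean N n f \<le> M"
  using assms(1)
proof (induction n arbitrary: f)
  case (Suc n)
  have "torus_mean N n (\<lambda>z. f (z(n := t))) \<le> M" if "norm t = 1" for t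
    using that by (intro Suc.IH Suc.prems) auto
  hence "torus_mean N (Suc n) f \<le> circle_mean N (\<lambda>t. M)"
    unfolding torus_mean.simps by (rule circle_mean_mono)
  thus ?case using assms(2) by (simp add: circle_mean_const)
qed simp

lemma sum_PiE_Suc:
  fixes g :: "(nat \<Rightarrow> 'a) \<Rightarrow> 'b::comm_monoid_add"
  shows "(\<Sum>\<alpha>\<in>PiE {..<Suc n} T. g \<alpha>) = (\<Sum>\<alpha>\<in>PiE {..<n} T. \<Sum>k\<in>T n. g (\<alpha>(n := k)))"
proof -
  have "(\<Sum>\<alpha>\<in>PiE {..<Suc n} T. g \<alpha>) = (\<Sum>x\<in>T n \<times> PiE {..<n} T. g ((snd x)(n := fst x)))"
    unfolding lessThan_Suc PiE_insert_eq
    by (subst sum.reindex[OF inj_combinator]) (simp_all add: case_prod_beta)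
  also have "\<dots> = (\<Sum>k\<in>T n. \<Sum>\<alpha>\<in>PiE {..<n} T. g (\<alpha>(n := k)))"
    by (simp add: sum.cartesian_product case_prod_beta)
  also have "\<dots> = (\<Sum>\<alpha>\<in>PiE {..<n} T. \<Sum>k\<in>T n. g (\<alpha>(n := k)))" by (rule sum.swap)
  finally show ?thesis .
qed

text \<open>
Minkowski's inequality for means.
\<close>

lemma L2_set_circle_mean_le:
  "L2_set (\<lambda>i. circle_mean N (f i)) I \<le> circle_mean N (\<lambda>t. L2_set (\<lambda>i. f i t) I)"
proof -
  have *: "L2_set (\<lambda>i. \<Sum>k\<in>K. g k i) I \<le> (\<Sum>k\<in>K. L2_set (g k) I)" if "finite K" for K :: "nat set" and g
    using that
  proof (induction K)
    case (insert k K)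
    thus ?case using L2_set_triangle_ineq[of "g k" "\<lambda>i. \<Sum>k\<in>K. g k i" I] by simp
  qed (simp add: L2_set_def)
  have "L2_set (\<lambda>i. circle_mean N (f i)) I = L2_set (\<lambda>i. \<Sum>k<N. f i (cis (2 * pi * real k / real N))) I / N"
    using L2_set_left_distrib[of "1 / N" _ I] by (simp add: circle_mean_def)
  also have "\<dots> \<le> (\<Sum>k<N. L2_set (\<lambda>i. f i (cis (2 * pi * real k / real N))) I) / N"
    by (intro divide_right_mono *) auto
  finally show ?thesis by (simp add: circle_mean_def)
qed

lemma circle_mean_lower_bound:
  fixes a :: "nat \<Rightarrow> complex"
  assumes "N > 0"
  shows "(1 - 2 * pi * real m * real (Suc m) * 2 ^ m / N) * sqrt (\<Sum>k\<le>m. (norm (a k))\<^sup>2 / 2 ^ k)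
    \<le> circle_mean N (\<lambda>z. norm (\<Sum>k\<le>m. a k * z ^ k))"
proof -
  define f where "f = (\<Sum>k\<le>m. monom (a k) k)"
  have deg: "degree f \<le> m"
    unfolding f_def by (intro degree_sum_le) (auto intro: order_trans[OF degree_monom_le])
  have cf: "coeff f k = a k" if "k \<le> m" for k
    using that by (simp add: f_def coeff_sum)
  have "damped_norm f = sqrt (\<Sum>k\<le>m. (norm (a k))\<^sup>2 / 2 ^ k)"
    unfolding damped_norm_extend[OF deg] by (simp add: cf)
  moreover have "poly f z = (\<Sum>k\<le>m. a k * z ^ k)" for z
    by (simp add: f_def poly_sum poly_monom)
  ultimately show ?thesis using damped_norm_le_circle_mean[OF deg assms] by simp
qed

text \<open>
Induction on the number of variables. For a fixed value \<open>t\<close> of the last variable the induction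
hypothesis gives an \<open>\<ell>\<^sub>2\<close> norm over the exponents of the other variables; Minkowski's inequality
moves the mean over \<open>t\<close> inside this norm, where the one-variable inequality applies to each
coefficient.
\<close>

lemma torus_mean_lower_bound:
  fixes c :: "(nat \<Rightarrow> nat) \<Rightarrow> complex"
  assumes "N > 0" and D: "2 * pi * real m * real (Suc m) * 2 ^ m \<le> N"
  shows "(1 - 2 * pi * real m * real (Suc m) * 2 ^ m / N) ^ n
      * sqrt (\<Sum>\<alpha>\<in>PiE {..<n} (\<lambda>_. {..m}). (norm (c \<alpha>))\<^sup>2 / 2 ^ (\<Sum>j<n. \<alpha> j))
    \<le> torus_mean N n (\<lambda>z. norm (\<Sum>\<alpha>\<in>PiE {..<n} (\<lambda>_. {..m}). c \<alpha> * (\<Prod>j<n. z j ^ \<alpha> j)))"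
proof (induction n arbitrary: c)
  case 0
  show ?case by simp
next
  case (Suc n)
  define \<kappa> where "\<kappa> = 1 - 2 * pi * real m * real (Suc m) * 2 ^ m / N"
  have \<kappa>: "\<kappa> \<ge> 0" using assms by (simp add: \<kappa>_def)
  let ?Q = "PiE {..<n} (\<lambda>_. {..m})"
  define c' where "c' = (\<lambda>t \<alpha>. \<Sum>k\<le>m. c (\<alpha>(n := k)) * t ^ k)"
  let ?w = "\<lambda>\<alpha>. 1 / sqrt (2 ^ (\<Sum>j<n. \<alpha> j))"
  have split: "(\<Sum>\<alpha>\<in>PiE {..<Suc n} (\<lambda>_. {..m}). c \<alpha> * (\<Prod>j<Suc n. (z(n := t)) j ^ \<alpha> j))
      = (\<Sum>\<alpha>\<in>?Q. c' t \<alpha> * (\<Prod>j<n. z j ^ \<alpha> j))" for z t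
    unfolding sum_PiE_Suc c'_def sum_distrib_right
    by (intro sum.cong refl) (simp add: mult_ac)
  have "\<kappa> ^ Suc n * sqrt (\<Sum>\<alpha>\<in>PiE {..<Suc n} (\<lambda>_. {..m}). (norm (c \<alpha>))\<^sup>2 / 2 ^ (\<Sum>j<Suc n. \<alpha> j))
      = \<kappa> ^ n * L2_set (\<lambda>\<alpha>. ?w \<alpha> * (\<kappa> * sqrt (\<Sum>k\<le>m. (norm (c (\<alpha>(n := k))))\<^sup>2 / 2 ^ k))) ?Q"
  proof -
    have "(\<Sum>\<alpha>\<in>PiE {..<Suc n} (\<lambda>_. {..m}). (norm (c \<alpha>))\<^sup>2 / 2 ^ (\<Sum>j<Suc n. \<alpha> j))
        = (\<Sum>\<alpha>\<in>?Q. (?w \<alpha> * sqrt (\<Sum>k\<le>m. (norm (c (\<alpha>(n := k))))\<^sup>2 / 2 ^ k))\<^sup>2)"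
      unfolding sum_PiE_Suc
    proof (intro sum.cong refl)
      fix \<alpha>
      have "(\<Sum>k\<le>m. (norm (c (\<alpha>(n := k))))\<^sup>2 / 2 ^ (\<Sum>j<Suc n. (\<alpha>(n := k)) j))
          = (\<Sum>k\<le>m. (norm (c (\<alpha>(n := k))))\<^sup>2 / 2 ^ k / 2 ^ (\<Sum>j<n. \<alpha> j))"
        by (intro sum.cong refl) (simp add: power_add)
      also have "\<dots> = (\<Sum>k\<le>m. (norm (c (\<alpha>(n := k))))\<^sup>2 / 2 ^ k) / 2 ^ (\<Sum>j<n. \<alpha> j)"
        by (rule sum_divide_distrib[symmetric])
      also have "\<dots> = (?w \<alpha> * sqrt (\<Sum>k\<le>m. (norm (c (\<alpha>(n := k))))\<^sup>2 / 2 ^ k))\<^sup>2"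
        unfolding power_mult_distrib power_divide by (subst (1 2) real_sqrt_pow2) (auto intro!: sum_nonneg)
      finally show "(\<Sum>k\<le>m. (norm (c (\<alpha>(n := k))))\<^sup>2 / 2 ^ (\<Sum>j<Suc n. (\<alpha>(n := k)) j))
          = (?w \<alpha> * sqrt (\<Sum>k\<le>m. (norm (c (\<alpha>(n := k))))\<^sup>2 / 2 ^ k))\<^sup>2" .
    qed
    moreover have "L2_set (\<lambda>\<alpha>. ?w \<alpha> * (\<kappa> * g \<alpha>)) ?Q = \<kappa> * L2_set (\<lambda>\<alpha>. ?w \<alpha> * g \<alpha>) ?Q" for g
      using L2_set_right_distrib[OF \<kappa>, of "\<lambda>\<alpha>. ?w \<alpha> * g \<alpha>" ?Q] by (simp add: mult_ac)
    ultimately show ?thesis by (simp add: L2_set_def)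
  qed
  also have "\<dots> \<le> \<kappa> ^ n * L2_set (\<lambda>\<alpha>. circle_mean N (\<lambda>t. ?w \<alpha> * norm (c' t \<alpha>))) ?Q"
  proof (intro mult_left_mono L2_set_mono)
    fix \<alpha>
    show "?w \<alpha> * (\<kappa> * sqrt (\<Sum>k\<le>m. (norm (c (\<alpha>(n := k))))\<^sup>2 / 2 ^ k))
        \<le> circle_mean N (\<lambda>t. ?w \<alpha> * norm (c' t \<alpha>))"
      unfolding circle_mean_mult c'_def \<kappa>_def
      by (rule mult_left_mono[OF circle_mean_lower_bound[OF assms(1)]]) simp
    show "0 \<le> ?w \<alpha> * (\<kappa> * sqrt (\<Sum>k\<le>m. (norm (c (\<alpha>(n := k))))\<^sup>2 / 2 ^ k))"
      by (intro mult_nonneg_nonneg \<kappa> real_sqrt_ge_zero sum_nonneg) auto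
  qed (use \<kappa> in simp)
  also have "\<dots> \<le> \<kappa> ^ n * circle_mean N (\<lambda>t. L2_set (\<lambda>\<alpha>. ?w \<alpha> * norm (c' t \<alpha>)) ?Q)"
    by (intro mult_left_mono L2_set_circle_mean_le) (use \<kappa> in auto)
  also have "\<dots> = circle_mean N (\<lambda>t. \<kappa> ^ n * sqrt (\<Sum>\<alpha>\<in>?Q. (norm (c' t \<alpha>))\<^sup>2 / 2 ^ (\<Sum>j<n. \<alpha> j)))"
    by (simp add: circle_mean_mult L2_set_def power_mult_distrib power_divide)
  also have "\<dots> \<le> circle_mean N (\<lambda>t. torus_mean N n (\<lambda>z. norm (\<Sum>\<alpha>\<in>?Q. c' t \<alpha> * (\<Prod>j<n. z j ^ \<alpha> j))))"
    by (intro circle_mean_mono Suc.IH[folded \<kappa>_def])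
  finally show ?case unfolding torus_mean.simps split \<kappa>_def .
qed

section \<open>A mixed-norm estimate for homogeneous polynomials\<close>

lemma total_degree_eq_sum:
  assumes "Poly_Mapping.keys \<alpha> \<subseteq> {..<n}"
  shows "total_degree \<alpha> = (\<Sum>j<n. Poly_Mapping.lookup \<alpha> j)"
  unfolding total_degree_def
  by (rule sum.mono_neutral_left) (use assms in \<open>auto simp: in_keys_iff\<close>)

text \<open>
The exponents of a homogeneous polynomial lie in the cube with side \<open>{..r}\<close>, and on them the
damping factor is the constant \<open>2\<^sup>r\<close>.
\<close>

lemma torus_mean_lower_bound_homogeneous:
  fixes c :: "(nat \<Rightarrow>\<^sub>0 nat) \<Rightarrow> complex"
  assumes S: "finite S" "\<And>\<alpha>. \<alpha> \<in> S \<Longrightarrow> Poly_Mapping.keys \<alpha> \<subseteq> {..<n}" "\<And>\<alpha>. \<alpha> \<in> S \<Longrightarrow> total_degree \<alpha> = r"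
    and N: "N > 0" "2 * pi * real r * real (Suc r) * 2 ^ r \<le> N"
  shows "(1 - 2 * pi * real r * real (Suc r) * 2 ^ r / N) ^ n * sqrt ((\<Sum>\<alpha>\<in>S. (norm (c \<alpha>))\<^sup>2) / 2 ^ r)
    \<le> torus_mean N n (\<lambda>z. norm (\<Sum>\<alpha>\<in>S. c \<alpha> * (\<Prod>j<n. z j ^ Poly_Mapping.lookup \<alpha> j)))"
proof -
  define \<phi> where "\<phi> = (\<lambda>\<alpha> :: nat \<Rightarrow>\<^sub>0 nat. restrict (Poly_Mapping.lookup \<alpha>) {..<n})"
  have inj: "inj_on \<phi> S"
  proof (rule inj_onI)
    fix \<alpha> \<beta> assume *: "\<alpha> \<in> S" "\<beta> \<in> S" "\<phi> \<alpha> = \<phi> \<beta>"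
    show "\<alpha> = \<beta>"
    proof (rule poly_mapping_eqI)
      fix j show "Poly_Mapping.lookup \<alpha> j = Poly_Mapping.lookup \<beta> j"
      proof (cases "j < n")
        case True
        thus ?thesis using fun_cong[OF *(3), of j] by (simp add: \<phi>_def)
      next
        case False
        hence "j \<notin> Poly_Mapping.keys \<alpha>" "j \<notin> Poly_Mapping.keys \<beta>" using S(2) *(1,2) by blast+
        thus ?thesis by (simp add: in_keys_iff)
      qed
    qed
  qed
  let ?Q = "PiE {..<n} (\<lambda>_. {..r})"
  have sub: "\<phi> ` S \<subseteq> ?Q"
  proof (rule image_subsetI)
    fix \<alpha> assume \<alpha>: "\<alpha> \<in> S"
    have "Poly_Mapping.lookup \<alpha> j \<le> r" if "j < n" for j
      using member_le_sum[of j "{..<n}" "Poly_Mapping.lookup \<alpha>"] S(3)[OF \<alpha>]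
        total_degree_eq_sum[OF S(2)[OF \<alpha>]] that by auto
    thus "\<phi> \<alpha> \<in> ?Q" by (auto simp: \<phi>_def)
  qed
  define c' where "c' = (\<lambda>\<beta>. if \<beta> \<in> \<phi> ` S then c (inv_into S \<phi> \<beta>) else 0)"
  have c': "c' (\<phi> \<alpha>) = c \<alpha>" if "\<alpha> \<in> S" for \<alpha>
    using that inj by (simp add: c'_def)
  have transfer: "(\<Sum>\<beta>\<in>?Q. g (c' \<beta>) \<beta>) = (\<Sum>\<alpha>\<in>S. g (c \<alpha>) (\<phi> \<alpha>))" if "\<And>\<beta>. g 0 \<beta> = 0"
    for g :: "complex \<Rightarrow> (nat \<Rightarrow> nat) \<Rightarrow> 'x :: comm_monoid_add"
  proof -
    have "(\<Sum>\<beta>\<in>?Q. g (c' \<beta>) \<beta>) = (\<Sum>\<beta>\<in>\<phi> ` S. g (c' \<beta>) \<beta>)"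
      by (rule sum.mono_neutral_right) (use sub that in \<open>auto simp: c'_def intro!: finite_PiE\<close>)
    also have "\<dots> = (\<Sum>\<alpha>\<in>S. g (c \<alpha>) (\<phi> \<alpha>))"
      by (simp add: sum.reindex[OF inj] c')
    finally show ?thesis .
  qed
  have deg: "(\<Sum>j<n. \<phi> \<alpha> j) = r" if "\<alpha> \<in> S" for \<alpha>
    using total_degree_eq_sum[OF S(2)[OF that]] S(3)[OF that] by (simp add: \<phi>_def)
  have "(\<Sum>\<alpha>\<in>?Q. (norm (c' \<alpha>))\<^sup>2 / 2 ^ (\<Sum>j<n. \<alpha> j)) = (\<Sum>\<alpha>\<in>S. (norm (c \<alpha>))\<^sup>2 / 2 ^ (\<Sum>j<n. \<phi> \<alpha> j))"
    by (rule transfer[of "\<lambda>x \<alpha>. (norm x)\<^sup>2 / 2 ^ (\<Sum>j<n. \<alpha> j)"]) simp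
  also have "\<dots> = (\<Sum>\<alpha>\<in>S. (norm (c \<alpha>))\<^sup>2) / 2 ^ r" by (simp add: deg sum_divide_distrib)
  finally have 1: "(\<Sum>\<alpha>\<in>?Q. (norm (c' \<alpha>))\<^sup>2 / 2 ^ (\<Sum>j<n. \<alpha> j)) = (\<Sum>\<alpha>\<in>S. (norm (c \<alpha>))\<^sup>2) / 2 ^ r" .
  have 2: "(\<Sum>\<alpha>\<in>?Q. c' \<alpha> * (\<Prod>j<n. z j ^ \<alpha> j))
      = (\<Sum>\<alpha>\<in>S. c \<alpha> * (\<Prod>j<n. z j ^ Poly_Mapping.lookup \<alpha> j))" for z
  proof -
    have "(\<Sum>\<alpha>\<in>?Q. c' \<alpha> * (\<Prod>j<n. z j ^ \<alpha> j)) = (\<Sum>\<alpha>\<in>S. c \<alpha> * (\<Prod>j<n. z j ^ \<phi> \<alpha> j))"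
      by (rule transfer[of "\<lambda>x \<alpha>. x * (\<Prod>j<n. z j ^ \<alpha> j)"]) simp
    thus ?thesis by (simp add: \<phi>_def)
  qed
  show ?thesis using torus_mean_lower_bound[OF N, of n c'] unfolding 1 2 .
qed

text \<open>
The sum is the derivative at \<open>t = 0\<close> of \<open>P (z\<^sub>j (1 + t y\<^sub>j))\<close> for unimodular \<open>y\<^sub>j\<close> that align the
phases. On the circle \<open>|t| = 1/r\<close> the argument has modulus at most \<open>1 + 1/r\<close>, where homogeneity
bounds \<open>P\<close> by \<open>(1 + 1/r)\<^sup>r M \<le> e M\<close>; Cauchy's estimate loses the further factor \<open>r\<close>.
\<close>

lemma sum_norm_euler_derivative_le:
  fixes b :: "(nat \<Rightarrow>\<^sub>0 nat) \<Rightarrow> complex"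
  assumes S: "finite S" "\<And>\<alpha>. \<alpha> \<in> S \<Longrightarrow> Poly_Mapping.keys \<alpha> \<subseteq> {..<n}" "\<And>\<alpha>. \<alpha> \<in> S \<Longrightarrow> total_degree \<alpha> = r"
    and r: "r \<ge> 1"
    and M: "\<And>z. (\<And>j. norm (z j) \<le> 1) \<Longrightarrow> norm (\<Sum>\<alpha>\<in>S. b \<alpha> * (\<Prod>j<n. z j ^ Poly_Mapping.lookup \<alpha> j)) \<le> M"
    and z: "\<And>j. norm (z j) = 1"
  shows "(\<Sum>j<n. norm (\<Sum>\<alpha>\<in>S. (of_nat (Poly_Mapping.lookup \<alpha> j) * b \<alpha>) * (\<Prod>i<n. z i ^ Poly_Mapping.lookup \<alpha> i)))
    \<le> exp 1 * real r * M"
proof -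
  let ?l = Poly_Mapping.lookup
  define d where "d = (\<lambda>j. \<Sum>\<alpha>\<in>S. (of_nat (?l \<alpha> j) * b \<alpha>) * (\<Prod>i<n. z i ^ ?l \<alpha> i))"
  define y where "y = (\<lambda>j. cnj (sgn (d j)))"
  have y: "norm (y j) \<le> 1" "y j * d j = norm (d j)" for j
  proof -
    show "norm (y j) \<le> 1" by (simp add: y_def norm_sgn)
    have "cnj (sgn (d j)) * (norm (d j) * sgn (d j)) = norm (d j)"
      by (cases "d j = 0") (simp_all add: sgn_eq complex_norm_square[symmetric] field_simps norm_divide
          flip: power2_eq_square)
    thus "y j * d j = norm (d j)" by (simp add: y_def sgn_eq split: if_splits)
  qed
  define f where "f = (\<lambda>t. \<Sum>\<alpha>\<in>S. b \<alpha> * (\<Prod>j<n. (z j * (1 + t * y j)) ^ ?l \<alpha> j))"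
  have deriv_f: "(f has_field_derivative (\<Sum>j<n. y j * d j)) (at 0)"
  proof -
    have factor: "((\<lambda>t. (z j * (1 + t * y j)) ^ k) has_field_derivative (of_nat k * y j * z j ^ k)) (at 0)" for j k
    proof -
      have "((\<lambda>t. z j * (1 + t * y j)) has_field_derivative z j * y j) (at 0)"
        by (auto intro!: derivative_eq_intros)
      from DERIV_power[OF this, of k] show ?thesis by (cases k) (simp_all add: algebra_simps)
    qed
    have "(f has_field_derivative (\<Sum>\<alpha>\<in>S. b \<alpha> * (\<Sum>j<n. of_nat (?l \<alpha> j) * y j * z j ^ ?l \<alpha> j
        * (\<Prod>i\<in>{..<n} - {j}. (z i * (1 + 0 * y i)) ^ ?l \<alpha> i)))) (at 0)"
      unfolding f_def by (intro DERIV_sum DERIV_cmult has_field_derivative_prod factor)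
    also have "(\<Sum>\<alpha>\<in>S. b \<alpha> * (\<Sum>j<n. of_nat (?l \<alpha> j) * y j * z j ^ ?l \<alpha> j
        * (\<Prod>i\<in>{..<n} - {j}. (z i * (1 + 0 * y i)) ^ ?l \<alpha> i)))
      = (\<Sum>\<alpha>\<in>S. \<Sum>j<n. y j * ((of_nat (?l \<alpha> j) * b \<alpha>) * (\<Prod>i<n. z i ^ ?l \<alpha> i)))"
      unfolding sum_distrib_left
    proof (intro sum.cong refl)
      fix \<alpha> j assume "j \<in> {..<n}"
      thus "b \<alpha> * (of_nat (?l \<alpha> j) * y j * z j ^ ?l \<alpha> j * (\<Prod>i\<in>{..<n} - {j}. (z i * (1 + 0 * y i)) ^ ?l \<alpha> i))
        = y j * ((of_nat (?l \<alpha> j) * b \<alpha>) * (\<Prod>i<n. z i ^ ?l \<alpha> i))"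
        by (simp add: prod.remove[of "{..<n}" j "\<lambda>i. z i ^ ?l \<alpha> i"] mult_ac)
    qed
    also have "\<dots> = (\<Sum>j<n. y j * d j)"
      by (subst sum.swap) (simp add: d_def sum_distrib_left)
    finally show ?thesis .
  qed
  have bound: "norm (f t) \<le> exp 1 * M" if t: "norm (0 - t) = 1 / r" for t
  proof -
    define s where "s = 1 + 1 / real r"
    have s: "s > 0" using r by (simp add: s_def add_pos_nonneg)
    define u where "u = (\<lambda>j. z j * (1 + t * y j) / of_real s)"
    have "norm (u j) \<le> 1" for j
    proof -
      have "norm (1 + t * y j) \<le> 1 + norm t * norm (y j)"
        using norm_triangle_ineq[of 1 "t * y j"] by (simp add: norm_mult)
      also have "\<dots> \<le> 1 + norm t * 1" by (intro add_left_mono mult_left_mono y) auto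
      also have "\<dots> = s" using t by (simp add: s_def)
      finally show ?thesis using s z[of j] by (simp add: u_def norm_mult norm_divide)
    qed
    from M[OF this] have u: "norm (\<Sum>\<alpha>\<in>S. b \<alpha> * (\<Prod>j<n. u j ^ ?l \<alpha> j)) \<le> M" .
    have "f t = of_real s ^ r * (\<Sum>\<alpha>\<in>S. b \<alpha> * (\<Prod>j<n. u j ^ ?l \<alpha> j))"
      unfolding f_def sum_distrib_left
    proof (intro sum.cong refl)
      fix \<alpha> assume \<alpha>: "\<alpha> \<in> S"
      have "(\<Prod>j<n. (z j * (1 + t * y j)) ^ ?l \<alpha> j) = (\<Prod>j<n. of_real s ^ ?l \<alpha> j * u j ^ ?l \<alpha> j)"
        using s by (intro prod.cong refl) (simp add: u_def flip: power_mult_distrib)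
      also have "\<dots> = of_real s ^ r * (\<Prod>j<n. u j ^ ?l \<alpha> j)"
        using total_degree_eq_sum[OF S(2)[OF \<alpha>]] S(3)[OF \<alpha>]
        by (simp add: prod.distrib flip: power_sum)
      finally show "b \<alpha> * (\<Prod>j<n. (z j * (1 + t * y j)) ^ ?l \<alpha> j)
        = of_real s ^ r * (b \<alpha> * (\<Prod>j<n. u j ^ ?l \<alpha> j))" by simp
    qed
    hence "norm (f t) = s ^ r * norm (\<Sum>\<alpha>\<in>S. b \<alpha> * (\<Prod>j<n. u j ^ ?l \<alpha> j))"
      using s by (simp add: norm_mult norm_power)
    also have "\<dots> \<le> exp 1 * M"
    proof (rule mult_mono[OF _ u])
      have "s ^ r \<le> exp (1 / real r) ^ r"
        using s exp_ge_add_one_self[of "1 / real r"] by (intro power_mono) (auto simp: s_def)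
      also have "\<dots> = exp 1" using r by (simp flip: exp_of_nat_mult)
      finally show "s ^ r \<le> exp 1" .
    qed auto
    finally show ?thesis .
  qed
  have "f holomorphic_on A" for A unfolding f_def by (intro holomorphic_intros)
  hence "norm ((deriv ^^ 1) f 0) \<le> fact 1 * (exp 1 * M) / (1 / real r) ^ 1"
    using r by (intro Cauchy_inequality bound holomorphic_on_imp_continuous_on) auto
  moreover have "deriv f 0 = (\<Sum>j<n. y j * d j)" using deriv_f by (rule DERIV_imp_deriv)
  ultimately have "norm (\<Sum>j<n. y j * d j) \<le> exp 1 * real r * M" by (simp add: mult_ac)
  moreover have "(\<Sum>j<n. y j * d j) = of_real (\<Sum>j<n. norm (d j))" by (simp add: y(2))
  ultimately have "(\<Sum>j<n. norm (d j)) \<le> exp 1 * real r * M"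
    by (simp only: norm_of_real)
  thus ?thesis by (simp add: d_def)
qed

text \<open>
On the torus the \<open>\<ell>\<^sub>1\<close> sum of the derivatives \<open>z\<^sub>j \<partial>\<^sub>j P\<close> is bounded pointwise, hence so is the sum of
their \<open>L\<^sup>1\<close> norms, and each of these controls the \<open>L\<^sup>2\<close> norm up to the factor \<open>\<surd>2\<^sup>r\<close>. This growth
rate is decisive, since \<open>\<surd>2\<^sup>r\<close> enters the final estimate with the power \<open>2r/p\<close>.
\<close>

lemma mixed_norm_le:
  fixes b :: "(nat \<Rightarrow>\<^sub>0 nat) \<Rightarrow> complex"
  assumes S: "finite S" "\<And>\<alpha>. \<alpha> \<in> S \<Longrightarrow> Poly_Mapping.keys \<alpha> \<subseteq> {..<n}" "\<And>\<alpha>. \<alpha> \<in> S \<Longrightarrow> total_degree \<alpha> = r"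
    and r: "r \<ge> 1"
    and M: "\<And>z. (\<And>j. norm (z j) \<le> 1) \<Longrightarrow> norm (\<Sum>\<alpha>\<in>S. b \<alpha> * (\<Prod>j<n. z j ^ Poly_Mapping.lookup \<alpha> j)) \<le> M"
  shows "(\<Sum>j<n. sqrt (\<Sum>\<alpha>\<in>S. (real (Poly_Mapping.lookup \<alpha> j))\<^sup>2 * (norm (b \<alpha>))\<^sup>2))
    \<le> exp 1 * real r * sqrt 2 ^ r * M"
proof -
  let ?l = Poly_Mapping.lookup
  define D where "D = 2 * pi * real r * real (Suc r) * 2 ^ r"
  define X where "X = (\<Sum>j<n. sqrt ((\<Sum>\<alpha>\<in>S. (norm (of_nat (?l \<alpha> j) * b \<alpha>))\<^sup>2) / 2 ^ r))"
  have le: "(1 - D / N) ^ n * X \<le> exp 1 * real r * M" if N: "N > 0" "D \<le> N" for N :: nat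
  proof -
    have "(1 - D / N) ^ n * X \<le> (\<Sum>j<n. torus_mean N n (\<lambda>z. norm (\<Sum>\<alpha>\<in>S. (of_nat (?l \<alpha> j) * b \<alpha>) * (\<Prod>i<n. z i ^ ?l \<alpha> i))))"
      unfolding X_def sum_distrib_left D_def
      by (intro sum_mono torus_mean_lower_bound_homogeneous S N[unfolded D_def])
    also have "\<dots> = torus_mean N n (\<lambda>z. \<Sum>j<n. norm (\<Sum>\<alpha>\<in>S. (of_nat (?l \<alpha> j) * b \<alpha>) * (\<Prod>i<n. z i ^ ?l \<alpha> i)))"
      by (rule torus_mean_sum[symmetric])
    also have "\<dots> \<le> exp 1 * real r * M"
      by (intro torus_mean_le sum_norm_euler_derivative_le S r M N(1))
    finally show ?thesis .
  qed
  have "(\<lambda>N. (1 - D / real N) ^ n * X) \<longlonglongrightarrow> (1 - 0) ^ n * X"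
    by (intro tendsto_intros lim_const_over_n)
  moreover have "eventually (\<lambda>N. (1 - D / real N) ^ n * X \<le> exp 1 * real r * M) sequentially"
    using eventually_ge_at_top[of "max 1 (nat \<lceil>D\<rceil>)"] by eventually_elim (intro le, auto)
  ultimately have "(1 - 0) ^ n * X \<le> exp 1 * real r * M"
    using tendsto_upperbound by fastforce
  moreover have "X = (\<Sum>j<n. sqrt (\<Sum>\<alpha>\<in>S. (real (?l \<alpha> j))\<^sup>2 * (norm (b \<alpha>))\<^sup>2)) / sqrt 2 ^ r"
    by (simp add: X_def norm_mult power_mult_distrib real_sqrt_divide real_sqrt_power)
       (rule sum_divide_distrib[symmetric])
  ultimately show ?thesis by (simp add: field_simps)
qed

section \<open>Weights adapted to the coefficients\<close>

text \<open>
Jensen's inequality for the exponential function.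
\<close>

lemma exp_sum_le:
  fixes \<mu> t :: "'i \<Rightarrow> real"
  assumes "finite I" "\<And>i. i \<in> I \<Longrightarrow> \<mu> i \<ge> 0" "(\<Sum>i\<in>I. \<mu> i) = 1"
  shows "exp (\<Sum>i\<in>I. \<mu> i * t i) \<le> (\<Sum>i\<in>I. \<mu> i * exp (t i))"
proof -
  have "I \<noteq> {}" using assms(3) by auto
  from convex_on_sum[OF assms(1) this exp_convex assms(3), of t] assms(2) show ?thesis by simp
qed

text \<open>
Normalise \<open>a\<^sup>q\<close> to a probability distribution \<open>\<mu>\<close> on the exponents and let \<open>\<rho>\<^sub>j\<close> be the mean of
\<open>e\<^sub>j/r\<close>. Put \<open>A = |a|\<^sub>q\<close>, \<open>L = \<Sum> \<mu> log \<mu>\<close> and \<open>h = \<Sum> \<rho> log \<rho>\<close>. By Jensen's inequality the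
\<open>q\<^sup>0\<close>-norm of \<open>f\<close> is at least \<open>A exp u\<close> and the mixed norm of \<open>f\<close> is at least \<open>A exp v\<close>, where
\<open>u = L (1/q - 1/q\<^sup>0) + r h/p\<close> and \<open>v = L (1/q - 1/2) + r h/p - h/2\<close>. The values of \<open>\<theta>\<close> and \<open>q\<close>
are exactly those for which \<open>(1 - \<theta>) u + \<theta> v = 0\<close>.
\<close>

lemma marginal_weights:
  fixes a :: "'i \<Rightarrow> real" and e :: "'i \<Rightarrow> nat \<Rightarrow> nat"
  assumes S: "finite S" "S \<noteq> {}" and a: "\<And>\<alpha>. \<alpha> \<in> S \<Longrightarrow> a \<alpha> > 0"
    and e: "\<And>\<alpha>. \<alpha> \<in> S \<Longrightarrow> (\<Sum>j<n. e \<alpha> j) = r" and r: "r \<ge> 1"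
    and q: "q > 0" "q0 > 0" and p: "p > 0"
    and \<theta>: "\<theta> = 2 * real r / p" "\<theta> \<le> 1" "1 / q = (1 - \<theta>) / q0 + \<theta> / 2"
  obtains \<rho> where "\<And>j. \<rho> j \<ge> 0" "(\<Sum>j<n. \<rho> j) = 1"
    "\<And>f. (\<And>\<alpha>. \<alpha> \<in> S \<Longrightarrow> f \<alpha> = a \<alpha> * (\<Prod>j<n. (\<rho> j powr (1 / p)) ^ e \<alpha> j)) \<Longrightarrow>
      (\<Sum>\<alpha>\<in>S. a \<alpha> powr q) powr (1 / q)
      \<le> ((\<Sum>\<alpha>\<in>S. f \<alpha> powr q0) powr (1 / q0)) powr (1 - \<theta>)
        * (\<Sum>j<n. sqrt (\<Sum>\<alpha>\<in>S. real (e \<alpha> j) / real r * (f \<alpha>)\<^sup>2)) powr \<theta>"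
proof -
  define T where "T = (\<Sum>\<alpha>\<in>S. a \<alpha> powr q)"
  have T: "T > 0" unfolding T_def using S by (intro sum_pos) (auto dest: a)
  define \<mu> where "\<mu> = (\<lambda>\<alpha>. a \<alpha> powr q / T)"
  have \<mu>: "\<mu> \<alpha> > 0" if "\<alpha> \<in> S" for \<alpha> using T a[OF that] by (simp add: \<mu>_def)
  have \<mu>1: "(\<Sum>\<alpha>\<in>S. \<mu> \<alpha>) = 1"
    using T by (simp add: \<mu>_def T_def flip: sum_divide_distrib)
  define m where "m = (\<lambda>j \<alpha>. real (e \<alpha> j) / real r * \<mu> \<alpha>)"
  define \<rho> where "\<rho> = (\<lambda>j. \<Sum>\<alpha>\<in>S. m j \<alpha>)"
  have m0: "m j \<alpha> \<ge> 0" if "\<alpha> \<in> S" for j \<alpha> using \<mu>[OF that] by (simp add: m_def)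
  have \<rho>0: "\<rho> j \<ge> 0" for j unfolding \<rho>_def by (intro sum_nonneg m0)
  have m_sum: "(\<Sum>j<n. m j \<alpha>) = \<mu> \<alpha>" if "\<alpha> \<in> S" for \<alpha>
    using e[OF that] r unfolding m_def
    by (simp flip: sum_distrib_right sum_divide_distrib of_nat_sum)
  have \<rho>1: "(\<Sum>j<n. \<rho> j) = 1"
    unfolding \<rho>_def by (subst sum.swap) (simp add: m_sum \<mu>1)
  \<comment> \<open>variables outside \<open>J\<close> do not occur in any of the exponents; removing them makes \<open>ln (\<rho> j)\<close> meaningful\<close>
  define J where "J = {j \<in> {..<n}. \<rho> j > 0}"
  have J: "finite J" "J \<subseteq> {..<n}" by (auto simp: J_def)
  have e0: "e \<alpha> j = 0" if "\<alpha> \<in> S" "j \<in> {..<n} - J" for \<alpha> j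
  proof -
    have "\<rho> j = 0" using \<rho>0[of j] that(2) by (auto simp: J_def)
    hence "m j \<alpha> = 0" using that(1) m0 S(1) by (simp add: \<rho>_def sum_nonneg_eq_0_iff)
    thus ?thesis using \<mu>[OF that(1)] r by (simp add: m_def)
  qed
  have \<rho>J: "(\<Sum>j\<in>J. \<rho> j) = 1"
    unfolding \<rho>1[symmetric] by (rule sum.mono_neutral_left) (use J \<rho>0 in \<open>auto simp: J_def less_le\<close>)
  have mJ: "(\<Sum>j\<in>J. m j \<alpha>) = \<mu> \<alpha>" if "\<alpha> \<in> S" for \<alpha>
    unfolding m_sum[OF that, symmetric]
    by (rule sum.mono_neutral_left) (use J e0[OF that] in \<open>auto simp: m_def\<close>)
  define l where "l = (\<lambda>\<alpha>. ln (\<mu> \<alpha>))"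
  define lam where "lam = (\<lambda>j. ln (\<rho> j))"
  define U where "U = (\<lambda>\<alpha>. \<Sum>j\<in>J. real (e \<alpha> j) * lam j)"
  define L where "L = (\<Sum>\<alpha>\<in>S. \<mu> \<alpha> * l \<alpha>)"
  define h where "h = (\<Sum>j\<in>J. \<rho> j * lam j)"
  have \<mu>_exp: "\<mu> \<alpha> = exp (l \<alpha>)" if "\<alpha> \<in> S" for \<alpha> using \<mu>[OF that] by (simp add: l_def)
  have \<rho>_exp: "\<rho> j = exp (lam j)" if "j \<in> J" for j using that by (simp add: lam_def J_def)
  \<comment> \<open>this is where the choice of \<open>\<rho>\<close> as the marginal of \<open>\<mu>\<close> enters\<close>
  have EU: "(\<Sum>\<alpha>\<in>S. \<mu> \<alpha> * U \<alpha>) = r * h"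
  proof -
    have "(\<Sum>\<alpha>\<in>S. \<mu> \<alpha> * U \<alpha>) = (\<Sum>\<alpha>\<in>S. \<Sum>j\<in>J. r * (m j \<alpha> * lam j))"
      unfolding U_def sum_distrib_left using r by (intro sum.cong refl) (simp add: m_def)
    also have "\<dots> = r * h"
      by (subst sum.swap) (simp add: h_def \<rho>_def sum_distrib_left sum_distrib_right)
    finally show ?thesis .
  qed
  define A where "A = T powr (1 / q)"
  have A: "A > 0" using T by (simp add: A_def)
  have a_eq: "a \<alpha> = A * exp (l \<alpha> / q)" if "\<alpha> \<in> S" for \<alpha>
  proof -
    have "A * exp (l \<alpha> / q) = (T * \<mu> \<alpha>) powr (1 / q)"
      using T \<mu>[OF that] by (simp add: A_def l_def powr_mult powr_def exp_add[symmetric] ln_mult algebra_simps)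
    also have "T * \<mu> \<alpha> = a \<alpha> powr q" using T by (simp add: \<mu>_def)
    finally show ?thesis using a[OF that] q by (simp add: powr_powr)
  qed
  show ?thesis
  proof (rule that[OF \<rho>0 \<rho>1])
    fix f assume f: "\<And>\<alpha>. \<alpha> \<in> S \<Longrightarrow> f \<alpha> = a \<alpha> * (\<Prod>j<n. (\<rho> j powr (1 / p)) ^ e \<alpha> j)"
    have f_eq: "f \<alpha> = A * exp (l \<alpha> / q + U \<alpha> / p)" if "\<alpha> \<in> S" for \<alpha>
    proof -
      have "(\<Prod>j<n. (\<rho> j powr (1 / p)) ^ e \<alpha> j) = (\<Prod>j\<in>J. (\<rho> j powr (1 / p)) ^ e \<alpha> j)"
        by (rule prod.mono_neutral_right) (use J e0[OF that] in auto)
      also have "\<dots> = (\<Prod>j\<in>J. exp (real (e \<alpha> j) * lam j / p))"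
        by (intro prod.cong refl) (simp add: \<rho>_exp powr_def flip: exp_of_nat_mult)
      also have "\<dots> = exp (U \<alpha> / p)" using J(1) by (simp add: U_def sum_divide_distrib exp_sum)
      finally show ?thesis using f[OF that] a_eq[OF that] by (simp add: exp_add mult_ac)
    qed
    define N0 where "N0 = (\<Sum>\<alpha>\<in>S. f \<alpha> powr q0) powr (1 / q0)"
    define mix where "mix = (\<Sum>j<n. sqrt (\<Sum>\<alpha>\<in>S. real (e \<alpha> j) / real r * (f \<alpha>)\<^sup>2))"
    have N0: "N0 \<ge> A * exp (L * (1 / q - 1 / q0) + r * h / p)"
    proof -
      define x where "x = (\<lambda>\<alpha>. q0 * (l \<alpha> / q + U \<alpha> / p) - l \<alpha>)"
      have "(\<Sum>\<alpha>\<in>S. \<mu> \<alpha> * x \<alpha>) = q0 * (L * (1 / q - 1 / q0) + r * h / p)"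
      proof -
        have "(\<Sum>\<alpha>\<in>S. \<mu> \<alpha> * x \<alpha>) = (\<Sum>\<alpha>\<in>S. (q0 / q - 1) * (\<mu> \<alpha> * l \<alpha>) + q0 / p * (\<mu> \<alpha> * U \<alpha>))"
          by (intro sum.cong refl) (simp add: x_def algebra_simps)
        also have "\<dots> = (q0 / q - 1) * L + q0 / p * (r * h)"
          by (simp only: sum.distrib sum_distrib_left[symmetric] EU L_def)
        also have "\<dots> = q0 * (L * (1 / q - 1 / q0) + r * h / p)" using q by (simp add: algebra_simps)
        finally show ?thesis .
      qed
      hence "A powr q0 * exp (q0 * (L * (1 / q - 1 / q0) + r * h / p)) \<le> A powr q0 * (\<Sum>\<alpha>\<in>S. \<mu> \<alpha> * exp (x \<alpha>))"
        using exp_sum_le[OF S(1) less_imp_le[OF \<mu>] \<mu>1, of x] by (simp add: mult_left_mono)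
      also have "\<dots> = (\<Sum>\<alpha>\<in>S. f \<alpha> powr q0)"
        unfolding sum_distrib_left
      proof (intro sum.cong refl)
        fix \<alpha> assume \<alpha>: "\<alpha> \<in> S"
        have "f \<alpha> powr q0 = A powr q0 * exp (q0 * (l \<alpha> / q + U \<alpha> / p))"
          using A by (simp add: f_eq[OF \<alpha>] powr_mult) (simp add: powr_def)
        also have "exp (q0 * (l \<alpha> / q + U \<alpha> / p)) = \<mu> \<alpha> * exp (x \<alpha>)"
          by (simp add: \<mu>_exp[OF \<alpha>] x_def flip: exp_add)
        finally show "A powr q0 * (\<mu> \<alpha> * exp (x \<alpha>)) = f \<alpha> powr q0" by simp
      qed
      finally have "(A powr q0 * exp (q0 * (L * (1 / q - 1 / q0) + r * h / p))) powr (1 / q0) \<le> N0"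
        unfolding N0_def using q by (intro powr_mono2) auto
      also have "(A powr q0 * exp (q0 * (L * (1 / q - 1 / q0) + r * h / p))) powr (1 / q0)
          = A * exp (L * (1 / q - 1 / q0) + r * h / p)"
        using A q by (simp add: powr_mult powr_powr) (simp add: powr_def)
      finally show ?thesis .
    qed
    have mix: "mix \<ge> A * exp (L * (1 / q - 1 / 2) + r * h / p - h / 2)"
    proof -
      define x where "x = (\<lambda>\<alpha>. 2 * l \<alpha> / q + 2 * U \<alpha> / p - l \<alpha>)"
      \<comment> \<open>Jensen is used twice: for fixed \<open>j\<close> with the weights \<open>m j \<alpha> / \<rho> j\<close>, then over \<open>j\<close> with \<open>\<rho>\<close>\<close>
      define y where "y = (\<lambda>j. ((\<Sum>\<alpha>\<in>S. m j \<alpha> / \<rho> j * x \<alpha>) - lam j) / 2)"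
      have "(\<Sum>j\<in>J. \<rho> j * y j) = L * (1 / q - 1 / 2) + r * h / p - h / 2"
      proof -
        have "(\<Sum>j\<in>J. \<rho> j * y j) = (\<Sum>j\<in>J. (\<Sum>\<alpha>\<in>S. m j \<alpha> * x \<alpha>) / 2 - \<rho> j * lam j / 2)"
        proof (intro sum.cong refl)
          fix j assume "j \<in> J"
          hence "\<rho> j \<noteq> 0" by (simp add: J_def)
          have "(\<Sum>\<alpha>\<in>S. m j \<alpha> * x \<alpha>) = \<rho> j * (\<Sum>\<alpha>\<in>S. m j \<alpha> / \<rho> j * x \<alpha>)"
            unfolding sum_distrib_left using \<open>\<rho> j \<noteq> 0\<close> by (intro sum.cong refl) simp
          thus "\<rho> j * y j = (\<Sum>\<alpha>\<in>S. m j \<alpha> * x \<alpha>) / 2 - \<rho> j * lam j / 2"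
            unfolding y_def by (simp add: right_diff_distrib diff_divide_distrib)
        qed
        also have "\<dots> = (\<Sum>j\<in>J. \<Sum>\<alpha>\<in>S. m j \<alpha> * x \<alpha>) / 2 - h / 2"
          by (simp add: h_def sum_subtractf sum_divide_distrib)
        also have "(\<Sum>j\<in>J. \<Sum>\<alpha>\<in>S. m j \<alpha> * x \<alpha>) = (\<Sum>\<alpha>\<in>S. \<mu> \<alpha> * x \<alpha>)"
          by (subst sum.swap) (simp add: mJ flip: sum_distrib_right)
        also have "\<dots> = (\<Sum>\<alpha>\<in>S. (2 / q - 1) * (\<mu> \<alpha> * l \<alpha>) + 2 / p * (\<mu> \<alpha> * U \<alpha>))"
          by (intro sum.cong refl) (simp add: x_def algebra_simps)
        also have "\<dots> = (2 / q - 1) * L + 2 / p * (r * h)"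
          by (simp only: sum.distrib sum_distrib_left[symmetric] EU L_def)
        also have "(\<dots>) / 2 - h / 2 = L * (1 / q - 1 / 2) + r * h / p - h / 2"
          by (simp add: algebra_simps add_divide_distrib diff_divide_distrib)
        finally show ?thesis .
      qed
      hence "A * exp (L * (1 / q - 1 / 2) + r * h / p - h / 2) \<le> A * (\<Sum>j\<in>J. \<rho> j * exp (y j))"
        using exp_sum_le[OF J(1) \<rho>0 \<rho>J, of y] A by simp
      also have "\<dots> = (\<Sum>j\<in>J. A * (\<rho> j * exp (y j)))" by (rule sum_distrib_left)
      also have "\<dots> \<le> (\<Sum>j\<in>J. sqrt (\<Sum>\<alpha>\<in>S. real (e \<alpha> j) / real r * (f \<alpha>)\<^sup>2))"
      proof (intro sum_mono real_le_rsqrt)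
        fix j assume j: "j \<in> J"
        hence \<rho>j: "\<rho> j > 0" by (simp add: J_def)
        have "(A * (\<rho> j * exp (y j)))\<^sup>2 = A\<^sup>2 * \<rho> j * exp (lam j + 2 * y j)"
          by (simp add: exp_add exp_double \<rho>_exp[OF j, symmetric] power_mult_distrib)
             (simp add: power2_eq_square)
        also have "lam j + 2 * y j = (\<Sum>\<alpha>\<in>S. m j \<alpha> / \<rho> j * x \<alpha>)" 
          unfolding y_def by (simp only: mult_2 field_sum_of_halves)
        also have "A\<^sup>2 * \<rho> j * exp \<dots> \<le> A\<^sup>2 * \<rho> j * (\<Sum>\<alpha>\<in>S. m j \<alpha> / \<rho> j * exp (x \<alpha>))"
        proof (intro mult_left_mono exp_sum_le S)
          show "(\<Sum>\<alpha>\<in>S. m j \<alpha> / \<rho> j) = 1" using \<rho>j by (simp add: \<rho>_def flip: sum_divide_distrib)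
        qed (use \<rho>j m0 in auto)
        also have "\<dots> = (\<Sum>\<alpha>\<in>S. real (e \<alpha> j) / real r * (f \<alpha>)\<^sup>2)"
          unfolding sum_distrib_left
        proof (intro sum.cong refl)
          fix \<alpha> assume \<alpha>: "\<alpha> \<in> S"
          have "\<mu> \<alpha> * exp (x \<alpha>) = (exp (l \<alpha> / q + U \<alpha> / p))\<^sup>2"
            by (simp add: \<mu>_exp[OF \<alpha>] x_def power2_eq_square flip: exp_add)
          thus "A\<^sup>2 * \<rho> j * (m j \<alpha> / \<rho> j * exp (x \<alpha>)) = real (e \<alpha> j) / real r * (f \<alpha>)\<^sup>2"
            using \<rho>j by (simp add: f_eq[OF \<alpha>] m_def power_mult_distrib)
        qed
        finally show "(A * (\<rho> j * exp (y j)))\<^sup>2 \<le> (\<Sum>\<alpha>\<in>S. real (e \<alpha> j) / real r * (f \<alpha>)\<^sup>2)" .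
      qed
      also have "\<dots> \<le> mix"
        unfolding mix_def using J(2) by (intro sum_mono2) (auto intro!: sum_nonneg)
      finally show ?thesis .
    qed
    have \<theta>0: "\<theta> \<ge> 0" using \<theta>(1) p by simp
    define u where "u = L * (1 / q - 1 / q0) + r * h / p"
    define v where "v = L * (1 / q - 1 / 2) + r * h / p - h / 2"
    have "(1 - \<theta>) * u + \<theta> * v = L * (1 / q - ((1 - \<theta>) / q0 + \<theta> / 2)) + h * (r / p - \<theta> / 2)"
      by (simp add: u_def v_def algebra_simps add_divide_distrib diff_divide_distrib)
    also have "\<dots> = 0" using \<theta> by simp
    finally have uv: "(1 - \<theta>) * u + \<theta> * v = 0" .
    have "A = A powr (1 - \<theta>) * A powr \<theta> * exp ((1 - \<theta>) * u + \<theta> * v)"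
      unfolding uv using A by (simp flip: powr_add)
    also have "\<dots> = (A * exp u) powr (1 - \<theta>) * (A * exp v) powr \<theta>"
      using A by (simp add: powr_mult exp_add) (simp add: powr_def mult_ac)
    also have "\<dots> \<le> N0 powr (1 - \<theta>) * mix powr \<theta>"
      using N0 mix A \<theta>(2) \<theta>0 unfolding u_def[symmetric] v_def[symmetric]
      by (intro mult_mono powr_mono2) auto
    finally show "(\<Sum>\<alpha>\<in>S. a \<alpha> powr q) powr (1 / q)
      \<le> ((\<Sum>\<alpha>\<in>S. f \<alpha> powr q0) powr (1 / q0)) powr (1 - \<theta>)
        * (\<Sum>j<n. sqrt (\<Sum>\<alpha>\<in>S. real (e \<alpha> j) / real r * (f \<alpha>)\<^sup>2)) powr \<theta>"
      by (simp only: A_def T_def N0_def mix_def)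
  qed
qed

section \<open>Polynomials on the unit ball of an lp space\<close>

lemma peval_superset:
  assumes "finite A" "Poly_Mapping.keys P \<subseteq> A"
  shows "peval P z = (\<Sum>\<alpha>\<in>A. Poly_Mapping.lookup P \<alpha> * (\<Prod>j\<in>Poly_Mapping.keys \<alpha>. z j ^ Poly_Mapping.lookup \<alpha> j))"
  unfolding peval_def
  by (rule sum.mono_neutral_left) (use assms in \<open>auto simp: in_keys_iff\<close>)

lemma peval_zero: "peval 0 z = 0"
  by (simp add: peval_def)

lemma peval_add: "peval (P + Q) z = peval P z + peval Q z"
proof -
  let ?A = "Poly_Mapping.keys P \<union> Poly_Mapping.keys Q \<union> Poly_Mapping.keys (P + Q)"
  show ?thesis
    by (subst (1 2 3) peval_superset[of ?A])
       (auto simp: lookup_add algebra_simps sum.distrib)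
qed

lemma peval_sum: "peval (\<Sum>i\<in>I. F i) z = (\<Sum>i\<in>I. peval (F i) z)"
  by (induction I rule: infinite_finite_induct) (simp_all add: peval_zero peval_add)

lemma prod_keys_eq:
  fixes \<alpha> :: "nat \<Rightarrow>\<^sub>0 nat" and z :: "nat \<Rightarrow> complex"
  assumes "Poly_Mapping.keys \<alpha> \<subseteq> {..<n}"
  shows "(\<Prod>j\<in>Poly_Mapping.keys \<alpha>. z j ^ Poly_Mapping.lookup \<alpha> j) = (\<Prod>j<n. z j ^ Poly_Mapping.lookup \<alpha> j)"
  by (rule prod.mono_neutral_left) (use assms in \<open>auto simp: in_keys_iff\<close>)

lemma homogeneous_onD:
  assumes "homogeneous_on n r P" "\<alpha> \<in> Poly_Mapping.keys P"
  shows "Poly_Mapping.keys \<alpha> \<subseteq> {..<n}" "total_degree \<alpha> = r"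
    "(\<Sum>j<n. Poly_Mapping.lookup \<alpha> j) = r"
  using assms total_degree_eq_sum[of \<alpha> n] by (auto simp: homogeneous_on_def)

lemma peval_homogeneous:
  assumes "homogeneous_on n r P" "finite A" "Poly_Mapping.keys P \<subseteq> A"
  shows "peval P z = (\<Sum>\<alpha>\<in>A. Poly_Mapping.lookup P \<alpha> * (\<Prod>j<n. z j ^ Poly_Mapping.lookup \<alpha> j))"
  unfolding peval_superset[OF assms(2,3)]
proof (intro sum.cong refl)
  fix \<alpha> assume "\<alpha> \<in> A"
  show "Poly_Mapping.lookup P \<alpha> * (\<Prod>j\<in>Poly_Mapping.keys \<alpha>. z j ^ Poly_Mapping.lookup \<alpha> j)
    = Poly_Mapping.lookup P \<alpha> * (\<Prod>j<n. z j ^ Poly_Mapping.lookup \<alpha> j)"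
  proof (cases "\<alpha> \<in> Poly_Mapping.keys P")
    case True
    from prod_keys_eq[OF homogeneous_onD(1)[OF assms(1) this]] show ?thesis by simp
  qed (simp add: in_keys_iff)
qed

lemma peval_homogeneous_scale:
  assumes "homogeneous_on n r P"
  shows "peval P (\<lambda>j. t * z j) = t ^ r * peval P z"
  unfolding peval_homogeneous[OF assms finite_keys order_refl] sum_distrib_left
proof (intro sum.cong refl)
  fix \<alpha> assume "\<alpha> \<in> Poly_Mapping.keys P"
  from homogeneous_onD(3)[OF assms this]
  have "(\<Prod>j<n. (t * z j) ^ Poly_Mapping.lookup \<alpha> j) = t ^ r * (\<Prod>j<n. z j ^ Poly_Mapping.lookup \<alpha> j)"
    by (simp add: power_mult_distrib prod.distrib flip: power_sum)
  thus "Poly_Mapping.lookup P \<alpha> * (\<Prod>j<n. (t * z j) ^ Poly_Mapping.lookup \<alpha> j)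
    = t ^ r * (Poly_Mapping.lookup P \<alpha> * (\<Prod>j<n. z j ^ Poly_Mapping.lookup \<alpha> j))" by simp
qed

text \<open>
The polynomial \<open>z \<mapsto> P (w z)\<close> for \<open>P\<close> in the first \<open>n\<close> variables.
\<close>

definition rescale :: "nat \<Rightarrow> (nat \<Rightarrow> real) \<Rightarrow> cpoly \<Rightarrow> cpoly" where
  "rescale n w P = Abs_poly_mapping (\<lambda>\<alpha>. Poly_Mapping.lookup P \<alpha> * of_real (\<Prod>j<n. w j ^ Poly_Mapping.lookup \<alpha> j))"

lemma lookup_rescale:
  "Poly_Mapping.lookup (rescale n w P) \<alpha> = Poly_Mapping.lookup P \<alpha> * of_real (\<Prod>j<n. w j ^ Poly_Mapping.lookup \<alpha> j)"
proof -
  have "finite {\<alpha>. Poly_Mapping.lookup P \<alpha> * of_real (\<Prod>j<n. w j ^ Poly_Mapping.lookup \<alpha> j) \<noteq> 0}"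
    by (rule finite_subset[OF _ finite_keys[of P]]) (auto simp: in_keys_iff)
  thus ?thesis unfolding rescale_def by simp
qed

lemma keys_rescale: "Poly_Mapping.keys (rescale n w P) \<subseteq> Poly_Mapping.keys P"
  by (auto simp: in_keys_iff lookup_rescale)

lemma homogeneous_on_rescale: "homogeneous_on n r P \<Longrightarrow> homogeneous_on n r (rescale m w P)"
  using keys_rescale unfolding homogeneous_on_def by blast

lemma peval_rescale:
  assumes "homogeneous_on n r P"
  shows "peval (rescale n w P) z = peval P (\<lambda>j. of_real (w j) * z j)"
  unfolding peval_homogeneous[OF assms finite_keys order_refl]
    peval_homogeneous[OF homogeneous_on_rescale[OF assms] finite_keys keys_rescale]
  by (intro sum.cong refl) (simp add: lookup_rescale power_mult_distrib prod.distrib)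

lemma coeff_norm_superset:
  assumes "finite A" "Poly_Mapping.keys P \<subseteq> A"
  shows "coeff_norm s P = (\<Sum>\<alpha>\<in>A. norm (Poly_Mapping.lookup P \<alpha>) powr s) powr (1 / s)"
  unfolding coeff_norm_def
  by (intro arg_cong2[where f="(powr)"] sum.mono_neutral_left refl) (use assms in \<open>auto simp: in_keys_iff\<close>)

lemma coeff_norm_nonneg: "coeff_norm s P \<ge> 0"
  by (simp add: coeff_norm_def)

lemma coeff_norm_le_scale:
  assumes "\<And>\<alpha>. norm (Poly_Mapping.lookup P \<alpha>) \<le> t * norm (Poly_Mapping.lookup Q \<alpha>)" and "t \<ge> 0" "s > 0"
  shows "coeff_norm s P \<le> t * coeff_norm s Q"
proof -
  let ?A = "Poly_Mapping.keys P \<union> Poly_Mapping.keys Q"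
  have "coeff_norm s P \<le> (\<Sum>\<alpha>\<in>?A. t powr s * norm (Poly_Mapping.lookup Q \<alpha>) powr s) powr (1 / s)"
    unfolding coeff_norm_superset[of ?A P, simplified]
    using assms by (intro powr_mono2 sum_mono sum_nonneg) (auto simp flip: powr_mult intro!: powr_mono2)
  also have "\<dots> = t * coeff_norm s Q"
    unfolding coeff_norm_superset[of ?A Q, simplified] sum_distrib_left[symmetric]
    using assms(2,3) by (simp add: powr_mult powr_powr sum_nonneg)
  finally show ?thesis .
qed

lemma lp_norm_le_1_iff:
  assumes "p > 0"
  shows "lp_norm n p z \<le> 1 \<longleftrightarrow> (\<Sum>j<n. norm (z j) powr p) \<le> 1"
proof -
  have "(x powr (1 / p) \<le> 1) = (x \<le> 1)" if "x \<ge> 0" for x :: real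
  proof
    assume "x powr (1 / p) \<le> 1"
    hence "(x powr (1 / p)) powr p \<le> 1 powr p" using assms by (intro powr_mono2) auto
    thus "x \<le> 1" using assms that by (simp add: powr_powr)
  qed (use powr_mono2[of "1 / p" x 1] that assms in simp)
  thus ?thesis by (simp add: lp_norm_def sum_nonneg)
qed

lemma lp_norm_weights_le_1:
  assumes "p > 0" "\<And>j. \<rho> j \<ge> 0" "(\<Sum>j<n. \<rho> j) \<le> 1" "\<And>j. j < n \<Longrightarrow> norm (z j) \<le> 1"
  shows "lp_norm n p (\<lambda>j. of_real (\<rho> j powr (1 / p)) * z j) \<le> 1"
proof -
  have "(\<Sum>j<n. norm (of_real (\<rho> j powr (1 / p)) * z j) powr p) \<le> (\<Sum>j<n. \<rho> j)"
  proof (intro sum_mono)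
    fix j assume "j \<in> {..<n}"
    hence "norm (z j) powr p \<le> 1 powr p" using assms by (intro powr_mono2) auto
    hence "\<rho> j * norm (z j) powr p \<le> \<rho> j" using assms(2)[of j] by (simp add: mult_left_le)
    thus "norm (of_real (\<rho> j powr (1 / p)) * z j) powr p \<le> \<rho> j"
      using assms(1,2) by (simp add: norm_mult powr_mult powr_powr)
  qed
  thus ?thesis using assms by (simp add: lp_norm_le_1_iff)
qed

lemma norm_le_1_of_lp_norm_le_1:
  assumes "p > 0" "lp_norm n p z \<le> 1" "j < n"
  shows "norm (z j) \<le> 1"
proof -
  have "norm (z j) powr p \<le> (\<Sum>j<n. norm (z j) powr p)"
    using assms(3) by (intro member_le_sum) auto
  also have "\<dots> \<le> 1" using assms by (simp add: lp_norm_le_1_iff)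
  finally have "(norm (z j) powr p) powr (1 / p) \<le> 1 powr (1 / p)" using assms(1) by (intro powr_mono2) auto
  thus ?thesis using assms(1) by (simp add: powr_powr)
qed

lemma norm_peval_le_sup_norm_lp_ball:
  assumes F: "\<forall>r\<le>R. homogeneous_on n r (F r)" and p: "p > 0" and z: "lp_norm n p z \<le> 1"
  shows "norm (peval (\<Sum>r\<le>R. F r) z) \<le> sup_norm_lp_ball n p (\<Sum>r\<le>R. F r)"
  unfolding sup_norm_lp_ball_def
proof (rule cSUP_upper)
  show "bdd_above ((\<lambda>z. norm (peval (\<Sum>r\<le>R. F r) z)) ` {z. lp_norm n p z \<le> 1})"
  proof (rule bdd_aboveI2)
    fix z assume z: "z \<in> {z. lp_norm n p z \<le> 1}"
    have "norm (peval (\<Sum>r\<le>R. F r) z) \<le> (\<Sum>r\<le>R. norm (peval (F r) z))"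
      unfolding peval_sum by (rule norm_sum)
    also have "\<dots> \<le> (\<Sum>r\<le>R. \<Sum>\<alpha>\<in>Poly_Mapping.keys (F r). norm (Poly_Mapping.lookup (F r) \<alpha>))"
    proof (intro sum_mono)
      fix r assume "r \<in> {..R}"
      hence "homogeneous_on n r (F r)" using F by simp
      note eq = peval_homogeneous[OF this finite_keys order_refl]
      show "norm (peval (F r) z) \<le> (\<Sum>\<alpha>\<in>Poly_Mapping.keys (F r). norm (Poly_Mapping.lookup (F r) \<alpha>))"
        unfolding eq
      proof (intro order_trans[OF norm_sum] sum_mono)
        fix \<alpha>
        have "norm (\<Prod>j<n. z j ^ Poly_Mapping.lookup \<alpha> j) \<le> 1"
          unfolding prod_norm[symmetric] norm_power
          using norm_le_1_of_lp_norm_le_1[OF p] z by (intro prod_le_1) (auto intro!: power_le_one)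
        thus "norm (Poly_Mapping.lookup (F r) \<alpha> * (\<Prod>j<n. z j ^ Poly_Mapping.lookup \<alpha> j))
            \<le> norm (Poly_Mapping.lookup (F r) \<alpha>)"
          by (simp add: norm_mult mult_left_le)
      qed
    qed
    finally show "norm (peval (\<Sum>r\<le>R. F r) z) \<le> \<dots>" .
  qed
qed (use z in simp)

text \<open>
The component \<open>F\<^sub>r\<close> is the mean of \<open>F (t z)\<close> against \<open>t\<^sup>-\<^sup>r\<close>, and the ball is invariant under rotation.
\<close>

lemma norm_peval_component_le:
  assumes F: "\<forall>r\<le>R. homogeneous_on n r (F r)" and p: "p > 0" and z: "lp_norm n p z \<le> 1"
    and r: "r \<le> R"
  shows "norm (peval (F r) z) \<le> sup_norm_lp_ball n p (\<Sum>r\<le>R. F r)"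
proof -
  let ?h = "\<lambda>t. peval (\<Sum>r\<le>R. F r) (\<lambda>j. t * z j) * cnj (t ^ r)"
  have "?h t = (\<Sum>k\<le>R. peval (F k) z * (t ^ k * cnj (t ^ r)))" for t
    unfolding peval_sum sum_distrib_right
    by (intro sum.cong refl) (simp add: peval_homogeneous_scale[OF F[rule_format]] mult_ac)
  hence "circle_mean (Suc R) ?h = (\<Sum>k\<le>R. peval (F k) z * circle_mean (Suc R) (\<lambda>t. t ^ k * cnj (t ^ r)))"
    by (simp only: circle_mean_sum circle_mean_mult)
  also have "\<dots> = (\<Sum>k\<le>R. if k = r then peval (F k) z else 0)"
    using r by (intro sum.cong refl) (simp add: circle_mean_orthogonal del: complex_cnj_power)
  also have "\<dots> = peval (F r) z" using r by simp
  finally have "peval (F r) z = circle_mean (Suc R) ?h" by simp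
  also have "norm \<dots> \<le> sup_norm_lp_ball n p (\<Sum>r\<le>R. F r)"
  proof (rule norm_circle_mean_le)
    fix t :: complex assume t: "norm t = 1"
    have "lp_norm n p (\<lambda>j. t * z j) \<le> 1" using z t by (simp add: lp_norm_def norm_mult)
    from norm_peval_le_sup_norm_lp_ball[OF F p this]
    show "norm (?h t) \<le> sup_norm_lp_ball n p (\<Sum>r\<le>R. F r)" using t by (simp add: norm_mult norm_power)
  qed simp
  finally show ?thesis .
qed

text \<open>
The estimate for a single degree, with the weights of \<open>marginal_weights\<close> for \<open>a\<^sub>\<alpha> = |P\<^sub>\<alpha>|\<close>. The
mixed estimate is applied to the rescaled polynomial, which is bounded by \<open>M\<close> on the polydisc.
\<close>

lemma coeff_norm_transfer:
  assumes P: "homogeneous_on n r P" and r: "r \<ge> 1" and p: "2 * real r \<le> p"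
    and M: "\<And>z. lp_norm n p z \<le> 1 \<Longrightarrow> norm (peval P z) \<le> M"
  obtains \<rho> where "\<And>j. \<rho> j \<ge> 0" "(\<Sum>j<n. \<rho> j) \<le> 1"
    "coeff_norm (q_exp r p) P \<le> coeff_norm (q0_exp r) (rescale n (\<lambda>j. \<rho> j powr (1 / p)) P) powr (1 - 2 * real r / p)
      * (exp 1 * real r * sqrt 2 ^ r * M) powr (2 * real r / p)"
proof (cases "Poly_Mapping.keys P = {}")
  case True
  show ?thesis
    by (rule that[of "\<lambda>_. 0"]) (simp_all add: coeff_norm_def[of _ P] True)
next
  case False
  let ?l = Poly_Mapping.lookup
  let ?S = "Poly_Mapping.keys P"
  define \<theta> where "\<theta> = 2 * real r / p"
  have p0: "p > 0" using p r by linarith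
  have \<theta>: "0 \<le> \<theta>" "\<theta> \<le> 1" using p p0 by (auto simp: \<theta>_def)
  have den: "real r * p + p - 2 * real r > 0" 
    using p mult_pos_pos[of "real r" p] r p0 by linarith
  have q: "q_exp r p > 0" "q0_exp r > 0" using den p0 r by (auto simp: q_exp_def q0_exp_def)
  have qq: "1 / q_exp r p = (1 - \<theta>) / q0_exp r + \<theta> / 2"
    using p0 r by (simp add: q_exp_def q0_exp_def \<theta>_def field_simps)
  obtain \<rho> where \<rho>: "\<And>j. \<rho> j \<ge> 0" "(\<Sum>j<n. \<rho> j) = 1" and main:
    "\<And>f. (\<And>\<alpha>. \<alpha> \<in> ?S \<Longrightarrow> f \<alpha> = norm (?l P \<alpha>) * (\<Prod>j<n. (\<rho> j powr (1 / p)) ^ ?l \<alpha> j)) \<Longrightarrow>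
      (\<Sum>\<alpha>\<in>?S. norm (?l P \<alpha>) powr q_exp r p) powr (1 / q_exp r p)
      \<le> ((\<Sum>\<alpha>\<in>?S. f \<alpha> powr q0_exp r) powr (1 / q0_exp r)) powr (1 - \<theta>)
        * (\<Sum>j<n. sqrt (\<Sum>\<alpha>\<in>?S. real (?l \<alpha> j) / real r * (f \<alpha>)\<^sup>2)) powr \<theta>"
    by (rule marginal_weights[of ?S "\<lambda>\<alpha>. norm (?l P \<alpha>)" ?l n r "q_exp r p" "q0_exp r" p \<theta>])
       (use False P r q p0 \<theta> qq \<theta>_def in \<open>auto simp: homogeneous_onD(3) in_keys_iff[symmetric]\<close>)
  define Q where "Q = rescale n (\<lambda>j. \<rho> j powr (1 / p)) P"
  have f: "norm (?l Q \<alpha>) = norm (?l P \<alpha>) * (\<Prod>j<n. (\<rho> j powr (1 / p)) ^ ?l \<alpha> j)" for \<alpha>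
    unfolding Q_def lookup_rescale norm_mult norm_of_real by (simp add: abs_prod power_abs)
  have keysQ: "Poly_Mapping.keys Q \<subseteq> ?S" unfolding Q_def by (rule keys_rescale)
  have Q: "homogeneous_on n r Q" unfolding Q_def using P by (rule homogeneous_on_rescale)
  have "(\<Sum>j<n. sqrt (\<Sum>\<alpha>\<in>?S. real (?l \<alpha> j) / real r * (norm (?l Q \<alpha>))\<^sup>2))
      \<le> (\<Sum>j<n. sqrt (\<Sum>\<alpha>\<in>?S. (real (?l \<alpha> j))\<^sup>2 * (norm (?l Q \<alpha>))\<^sup>2))"
  proof (intro sum_mono real_sqrt_le_mono mult_right_mono)
    fix \<alpha> j
    have "real (?l \<alpha> j) / real r \<le> real (?l \<alpha> j)"
      using r mult_left_mono[of 1 "real r" "real (?l \<alpha> j)"] by (simp add: field_simps)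
    also have "\<dots> \<le> (real (?l \<alpha> j))\<^sup>2" by (cases "?l \<alpha> j = 0") (auto simp: power2_eq_square)
    finally show "real (?l \<alpha> j) / real r \<le> (real (?l \<alpha> j))\<^sup>2" .
  qed auto
  also have "\<dots> \<le> exp 1 * real r * sqrt 2 ^ r * M"
  proof (rule mixed_norm_le[OF finite_keys homogeneous_onD(1,2)[OF P] r])
    fix z :: "nat \<Rightarrow> complex" assume z: "\<And>j. norm (z j) \<le> 1"
    have "norm (peval P (\<lambda>j. of_real (\<rho> j powr (1 / p)) * z j)) \<le> M"
      by (intro M lp_norm_weights_le_1) (use p0 \<rho> z in auto)
    thus "norm (\<Sum>\<alpha>\<in>?S. ?l Q \<alpha> * (\<Prod>j<n. z j ^ ?l \<alpha> j)) \<le> M"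
      unfolding peval_rescale[OF P, symmetric] Q_def[symmetric]
        peval_homogeneous[OF Q finite_keys keysQ] .
  qed
  finally have mix: "(\<Sum>j<n. sqrt (\<Sum>\<alpha>\<in>?S. real (?l \<alpha> j) / real r * (norm (?l Q \<alpha>))\<^sup>2))
      \<le> exp 1 * real r * sqrt 2 ^ r * M" .
  have "coeff_norm (q_exp r p) P \<le> coeff_norm (q0_exp r) Q powr (1 - \<theta>)
      * (\<Sum>j<n. sqrt (\<Sum>\<alpha>\<in>?S. real (?l \<alpha> j) / real r * (norm (?l Q \<alpha>))\<^sup>2)) powr \<theta>"
    using main[of "\<lambda>\<alpha>. norm (?l Q \<alpha>)"] f
    by (simp add: coeff_norm_def[of _ P] coeff_norm_superset[OF finite_keys keysQ])
  also have "\<dots> \<le> coeff_norm (q0_exp r) Q powr (1 - \<theta>) * (exp 1 * real r * sqrt 2 ^ r * M) powr \<theta>"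
    by (intro mult_left_mono powr_mono2 mix) (use \<theta> in \<open>auto intro!: sum_nonneg\<close>)
  finally show ?thesis using that[of \<rho>] \<rho> by (simp add: Q_def \<theta>_def)
qed

section \<open>Summation over the degrees\<close>

lemma powr_weighted_am_gm:
  fixes x y :: real
  assumes "0 \<le> \<theta>" "\<theta> \<le> 1" "x \<ge> 0" "y \<ge> 0"
  shows "x powr (1 - \<theta>) * y powr \<theta> \<le> x + \<theta> * y"
proof (cases "x = 0 \<or> y = 0")
  case False
  hence "x powr (1 - \<theta>) * y powr \<theta> \<le> (1 - \<theta>) * x + \<theta> * y"
    using assms by (intro Youngs_inequality_0) auto
  also have "\<dots> \<le> x + \<theta> * y" using assms by (simp add: mult_left_le_one_le)
  finally show ?thesis .
qed (use assms in auto)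

lemma reciprocal_exponent_le:
  fixes c p :: real and R :: nat
  assumes c: "c > 0" and R: "R \<ge> 2" and p: "p > 0" "p \<ge> c * (real R)\<^sup>2 / ln (real R)"
  shows "1 / p \<le> ln (real R) / (c * (real R)\<^sup>2)"
proof -
  have "ln (real R) > 0" using R by simp
  hence "c * (real R)\<^sup>2 \<le> p * ln (real R)" using p by (simp add: field_simps)
  thus ?thesis using p(1) c R by (simp add: field_simps)
qed

text \<open>
The first bound uses \<open>log R \<le> 2 \<surd>R\<close>. The second one makes 2 to the power \<open>2 r\<^sup>2/p\<close> at most a constant times
\<open>r\<close> to the power \<open>2 log 2 / c\<close>, in terms of \<open>r\<close> although \<open>p\<close> is controlled by \<open>R\<close> only. It
holds because \<open>t\<^sup>2 log (1/t) \<le> 1\<close> for \<open>t = r/R\<close>.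
\<close>

lemma degree_exponent_bounds:
  fixes c p :: real and R r :: nat
  assumes c: "c > 0" and R: "R \<ge> 2" and r: "1 \<le> r" "r \<le> R"
    and p: "p > 0" "p \<ge> c * (real R)\<^sup>2 / ln (real R)"
  shows "real r / p * ln (real R) \<le> 4 / c" and "(real r)\<^sup>2 / p \<le> (ln (real r) + 1) / c"
proof -
  have lnR: "ln (real R) > 0" using R by simp
  note inv = reciprocal_exponent_le[OF c R p]
  have "ln (real R) = 2 * ln (sqrt (real R))" using R by (simp add: ln_sqrt)
  also have "\<dots> \<le> 2 * sqrt (real R)" 
  proof -
    have "sqrt (real R) > 0" using R by simp
    from ln_less_self[OF this] show ?thesis by linarith
  qed
  finally have "(ln (real R))\<^sup>2 \<le> (2 * sqrt (real R))\<^sup>2" using lnR by (intro power_mono) auto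
  hence sq: "(ln (real R))\<^sup>2 \<le> 4 * real R" by (simp add: power_mult_distrib)
  have "real r / p * ln (real R) = real r * ln (real R) * (1 / p)" by simp
  also have "\<dots> \<le> real R * ln (real R) * (ln (real R) / (c * (real R)\<^sup>2))"
    using r lnR inv p by (intro mult_mono) auto
  also have "\<dots> = (ln (real R))\<^sup>2 / (c * real R)"
    using R by (simp add: power2_eq_square)
  also have "\<dots> \<le> 4 * real R / (c * real R)" using sq c by (intro divide_right_mono) auto
  also have "\<dots> = 4 / c" using R by simp
  finally show "real r / p * ln (real R) \<le> 4 / c" .
  define t where "t = real r / real R"
  have t: "0 < t" "t \<le> 1" using r R by (auto simp: t_def)
  have "ln (real R) = ln (real r) + ln (1 / t)"
    using r R by (simp add: t_def ln_div)
  hence "t\<^sup>2 * ln (real R) = t\<^sup>2 * ln (real r) + t\<^sup>2 * ln (1 / t)" by (simp add: distrib_left)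
  also have "\<dots> \<le> 1 * ln (real r) + t\<^sup>2 * (1 / t)"
  proof (intro add_mono mult_right_mono mult_left_mono)
    show "t\<^sup>2 \<le> 1" using t by (simp add: power_le_one)
    show "ln (1 / t) \<le> 1 / t" 
    proof -
      have "1 / t > 0" using t by simp
      from ln_less_self[OF this] show ?thesis by linarith
    qed
  qed (use r in auto)
  also have "\<dots> \<le> ln (real r) + 1" using t by (simp add: power2_eq_square)
  finally have *: "t\<^sup>2 * ln (real R) \<le> ln (real r) + 1" .
  have "(real r)\<^sup>2 / p \<le> (real r)\<^sup>2 * (ln (real R) / (c * (real R)\<^sup>2))"
    using mult_left_mono[OF inv, of "(real r)\<^sup>2"] by simp
  also have "\<dots> = t\<^sup>2 * ln (real R) / c" using R c by (simp add: t_def power_divide)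
  also have "\<dots> \<le> (ln (real r) + 1) / c" using * c by (intro divide_right_mono) auto
  finally show "(real r)\<^sup>2 / p \<le> (ln (real r) + 1) / c" .
qed

text \<open>
The parameters \<open>\<theta>\<^sub>r = 2r/p\<close> alone sum to a multiple of \<open>log R\<close>. The slack \<open>r\<^sup>-\<^sup>2\<^sup>\<delta>\<close> in the weights
removes this logarithm, because large \<open>r\<close> dominate the sum.
\<close>

lemma sum_interpolation_parameters_le:
  fixes c p \<delta> :: real and R :: nat
  assumes c: "c > 0" and R: "R \<ge> 2" and \<delta>: "0 < \<delta>" "\<delta> \<le> 1 / 2"
    and p: "p > 0" "p \<ge> c * (real R)\<^sup>2 / ln (real R)"
  shows "(\<Sum>r=1..R. 2 * real r / p * real r powr (- 2 * \<delta>)) \<le> 1 / (c * \<delta>)"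
proof -
  have lnR: "ln (real R) > 0" using R by simp
  note inv = reciprocal_exponent_le[OF c R p]
  have "(\<Sum>r=1..R. 2 * real r / p * real r powr (- 2 * \<delta>)) \<le> (\<Sum>r=1..R. 2 / p * real R powr (1 - 2 * \<delta>))"
  proof (intro sum_mono)
    fix r assume r: "r \<in> {1..R}"
    have "real r * real r powr (- 2 * \<delta>) = real r powr (1 - 2 * \<delta>)"
      by (simp add: powr_mult_base)
    also have "\<dots> \<le> real R powr (1 - 2 * \<delta>)" using r \<delta> by (intro powr_mono2) auto
    finally have "2 / p * (real r * real r powr (- 2 * \<delta>)) \<le> 2 / p * real R powr (1 - 2 * \<delta>)"
      using p r by (intro mult_left_mono) auto
    thus "2 * real r / p * real r powr (- 2 * \<delta>) \<le> 2 / p * real R powr (1 - 2 * \<delta>)" by simp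
  qed
  also have "\<dots> = 2 * (real R * real R powr (1 - 2 * \<delta>)) * (1 / p)" by simp
  also have "\<dots> \<le> 2 * (real R * real R powr (1 - 2 * \<delta>)) * (ln (real R) / (c * (real R)\<^sup>2))"
    by (intro mult_left_mono inv) auto
  also have "\<dots> = 2 * ln (real R) * real R powr (- 2 * \<delta>) / c"
  proof -
    have "real R * real R powr (1 - 2 * \<delta>) = (real R)\<^sup>2 * real R powr (- 2 * \<delta>)"
      using R by (simp add: powr_diff powr_minus field_simps power2_eq_square)
    thus ?thesis using R by simp
  qed
  also have "\<dots> \<le> 1 / (c * \<delta>)"
  proof -
    have "2 * \<delta> * ln (real R) = ln (real R powr (2 * \<delta>))" using R by (simp add: ln_powr)
    also have "\<dots> \<le> real R powr (2 * \<delta>)" using ln_less_self[of "real R powr (2 * \<delta>)"] R by simp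
    finally have "2 * \<delta> * ln (real R) * real R powr (- 2 * \<delta>) \<le> real R powr (2 * \<delta>) * real R powr (- 2 * \<delta>)"
      by (rule mult_right_mono) simp
    also have "\<dots> = 1" using R by (simp flip: powr_add)
    finally show ?thesis using c \<delta> by (simp add: field_simps)
  qed
  finally show ?thesis .
qed

text \<open>
Collects the bounded losses in one degree: \<open>24/c\<close> from the powers \<open>R\<^sup>\<theta>\<close> and \<open>r\<^sup>2\<^sup>\<theta>\<close>, 2 from the
power of \<open>e\<close>, \<open>2 log 2 / c\<close> from the additive constant in the bound for \<open>r\<^sup>2/p\<close>, and the rest from
raising the weight \<open>r\<^sup>2\<^sup>b\<close> to the power \<open>1 - \<theta>\<close> instead of 1.
\<close>

definition loss_constant :: "real \<Rightarrow> real \<Rightarrow> real" where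
  "loss_constant c b = exp (24 / c + 2 + 2 * ln 2 / c + 16 * \<bar>b\<bar> / c)"

text \<open>
The single-degree estimate after weighted arithmetic--geometric means. All factors that
carry the exponent \<open>\<theta> = 2r/p\<close> are bounded, except 2 to the power \<open>r \<theta>\<close>, which is paid for by
\<open>log 2 / c\<close> in the weight.
\<close>

lemma graded_term_le:
  fixes c p b \<delta> g M y :: real and R r :: nat
  assumes c: "c > 0" and R: "R \<ge> 2" and r: "1 \<le> r" "r \<le> R"
    and p: "2 * real R \<le> p" "p \<ge> c * (real R)\<^sup>2 / ln (real R)"
    and \<delta>: "\<delta> \<ge> 0" and nonneg: "g \<ge> 0" "M \<ge> 0" "y \<ge> 0"
    and y: "y \<le> (real R powr (real r / p) * g) powr (1 - 2 * real r / p)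
        * (exp 1 * real r * sqrt 2 ^ r * M) powr (2 * real r / p)"
  shows "y\<^sup>2 / real r powr (2 * (b + ln 2 / c + \<delta>))
    \<le> loss_constant c b * (g\<^sup>2 / real r powr (2 * b) + 2 * real r / p * real r powr (- 2 * \<delta>) * M\<^sup>2)"
proof -
  define \<theta> where "\<theta> = 2 * real r / p"
  have p0: "p > 0" using p R by linarith
  have \<theta>: "0 \<le> \<theta>" "\<theta> \<le> 1" using p p0 r by (auto simp: \<theta>_def field_simps)
  define x where "x = g\<^sup>2 / real r powr (2 * b)"
  have x0: "x \<ge> 0" by (simp add: x_def)
  note bounds = degree_exponent_bounds[OF c R r p0 p(2)]
  have lnr: "0 \<le> ln (real r)" "ln (real r) \<le> ln (real R)" using r by auto
  have \<theta>R: "\<theta> * ln (real R) \<le> 8 / c" using bounds(1) by (simp add: \<theta>_def)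
  have \<theta>r: "0 \<le> \<theta> * ln (real r)" "\<theta> * ln (real r) \<le> 8 / c"
    using \<theta>(1) lnr mult_left_mono[OF lnr(2) \<theta>(1)] \<theta>R by auto
  have sq: "(u powr a)\<^sup>2 = (u\<^sup>2) powr a" if "u \<ge> 0" for u a :: real
    using that by (simp add: power2_eq_square powr_mult)
  have "y\<^sup>2 \<le> ((real R powr (real r / p) * g) powr (1 - \<theta>) * (exp 1 * real r * sqrt 2 ^ r * M) powr \<theta>)\<^sup>2"
    using y nonneg unfolding \<theta>_def by (intro power_mono) auto
  also have "\<dots> = ((real R powr (real r / p) * g)\<^sup>2) powr (1 - \<theta>) * ((exp 1 * real r * sqrt 2 ^ r * M)\<^sup>2) powr \<theta>"
    by (subst power_mult_distrib, intro arg_cong2[where f="(*)"] sq) (use nonneg in auto)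
  also have "(real R powr (real r / p) * g)\<^sup>2 = exp (\<theta> * ln (real R) + 2 * b * ln (real r)) * x"
  proof -
    have "(real R powr (real r / p))\<^sup>2 = exp (\<theta> * ln (real R))"
      using R by (simp add: powr_def \<theta>_def power2_eq_square flip: exp_add)
    moreover have "g\<^sup>2 = exp (2 * b * ln (real r)) * x"
      using r by (simp add: x_def powr_def)
    ultimately show ?thesis by (simp add: power_mult_distrib exp_add)
  qed
  also have "(exp 1 * real r * sqrt 2 ^ r * M)\<^sup>2 = exp (2 + 2 * ln (real r) + real r * ln 2) * M\<^sup>2"
  proof -
    have "exp (2 + 2 * ln (real r) + real r * ln 2) = exp 2 * (exp (ln (real r)))\<^sup>2 * exp (ln 2) ^ r"
      by (simp only: exp_add exp_of_nat_mult exp_double)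
    also have "\<dots> = (exp 1)\<^sup>2 * (real r)\<^sup>2 * 2 ^ r" using r by (simp flip: exp_double)
    also have "\<dots> = (exp 1)\<^sup>2 * (real r)\<^sup>2 * (sqrt 2 ^ r)\<^sup>2"
      by (simp flip: power_mult) (simp add: power_mult mult.commute[of r])
    finally show ?thesis by (simp add: power_mult_distrib)
  qed
  also have "(exp (\<theta> * ln (real R) + 2 * b * ln (real r)) * x) powr (1 - \<theta>)
      * (exp (2 + 2 * ln (real r) + real r * ln 2) * M\<^sup>2) powr \<theta>
    = exp ((1 - \<theta>) * (\<theta> * ln (real R) + 2 * b * ln (real r)) + \<theta> * (2 + 2 * ln (real r) + real r * ln 2))
      * (x powr (1 - \<theta>) * (M\<^sup>2) powr \<theta>)"
  proof -
    have *: "exp u powr a = exp (a * u)" for u a :: real by (simp add: powr_def)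
    have "(exp u * x') powr a * (exp v * y') powr d = exp (a * u + d * v) * (x' powr a * y' powr d)"
      for u v x' y' a d :: real
      unfolding powr_mult * exp_add by (rule mult.commute[THEN trans]) (simp only: mult_ac)
    thus ?thesis .
  qed
  also have "\<dots> \<le> exp (24 / c + 2 + 2 * ln 2 / c + 16 * \<bar>b\<bar> / c + 2 * (b + ln 2 / c) * ln (real r))
      * (x + \<theta> * M\<^sup>2)"
  proof (intro mult_mono powr_weighted_am_gm)
    have "(1 - \<theta>) * (\<theta> * ln (real R)) \<le> 1 * (\<theta> * ln (real R))"
      using \<theta> lnr by (intro mult_right_mono) auto
    moreover have "- (2 * b * (\<theta> * ln (real r))) \<le> 2 * \<bar>b\<bar> * (8 / c)"
    proof -
      have "- (2 * b * (\<theta> * ln (real r))) \<le> 2 * \<bar>b\<bar> * (\<theta> * ln (real r))"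
        using \<theta>r(1) mult_right_mono[of "- (2 * b)" "2 * \<bar>b\<bar>" "\<theta> * ln (real r)"] by simp
      also have "\<dots> \<le> 2 * \<bar>b\<bar> * (8 / c)" by (intro mult_left_mono \<theta>r) auto
      finally show ?thesis .
    qed
    moreover have "\<theta> * real r * ln 2 \<le> 2 * ln 2 / c * ln (real r) + 2 * ln 2 / c"
    proof -
      have "\<theta> * real r * ln 2 = 2 * ln 2 * ((real r)\<^sup>2 / p)" by (simp add: \<theta>_def power2_eq_square)
      also have "\<dots> \<le> 2 * ln 2 * ((ln (real r) + 1) / c)" by (intro mult_left_mono bounds(2)) auto
      also have "\<dots> = 2 * ln 2 / c * ln (real r) + 2 * ln 2 / c"
        by (simp add: algebra_simps add_divide_distrib)
      finally show ?thesis .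
    qed
    ultimately have "(1 - \<theta>) * (\<theta> * ln (real R)) + 2 * b * ln (real r) + - (2 * b * (\<theta> * ln (real r)))
        + (2 * \<theta> + 2 * (\<theta> * ln (real r)) + \<theta> * real r * ln 2)
      \<le> 8 / c + 2 * b * ln (real r) + 2 * \<bar>b\<bar> * (8 / c) + (2 + 2 * (8 / c)
        + (2 * ln 2 / c * ln (real r) + 2 * ln 2 / c))"
      using \<theta>R \<theta>r \<theta> by linarith
    thus "exp ((1 - \<theta>) * (\<theta> * ln (real R) + 2 * b * ln (real r)) + \<theta> * (2 + 2 * ln (real r) + real r * ln 2))
      \<le> exp (24 / c + 2 + 2 * ln 2 / c + 16 * \<bar>b\<bar> / c + 2 * (b + ln 2 / c) * ln (real r))"
      by (simp add: algebra_simps)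
  qed (use \<theta> x0 in auto)
  also have "exp (24 / c + 2 + 2 * ln 2 / c + 16 * \<bar>b\<bar> / c + 2 * (b + ln 2 / c) * ln (real r))
      = loss_constant c b * real r powr (2 * (b + ln 2 / c))"
    using r by (simp add: loss_constant_def powr_def exp_add)
  finally have "y\<^sup>2 \<le> loss_constant c b * real r powr (2 * (b + ln 2 / c)) * (x + \<theta> * M\<^sup>2)" .
  hence "y\<^sup>2 / real r powr (2 * (b + ln 2 / c + \<delta>))
      \<le> loss_constant c b * real r powr (2 * (b + ln 2 / c)) * (x + \<theta> * M\<^sup>2) / real r powr (2 * (b + ln 2 / c + \<delta>))"
    by (rule divide_right_mono) simp
  also have "\<dots> = loss_constant c b * (real r powr (- 2 * \<delta>) * (x + \<theta> * M\<^sup>2))"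
  proof -
    have "real r powr (2 * (b + ln 2 / c + \<delta>)) = real r powr (2 * (b + ln 2 / c)) * real r powr (2 * \<delta>)"
      by (simp add: distrib_left flip: powr_add)
    thus ?thesis using r by (simp add: powr_minus field_simps)
  qed
  also have "\<dots> \<le> loss_constant c b * (x + \<theta> * real r powr (- 2 * \<delta>) * M\<^sup>2)"
  proof (intro mult_left_mono)
    have "real r powr (- 2 * \<delta>) \<le> real r powr 0" using r \<delta> by (intro powr_mono) auto
    hence "real r powr (- 2 * \<delta>) * x \<le> x" using r x0 by (simp add: mult_left_le_one_le)
    thus "real r powr (- 2 * \<delta>) * (x + \<theta> * M\<^sup>2) \<le> x + \<theta> * real r powr (- 2 * \<delta>) * M\<^sup>2"
      by (simp add: algebra_simps)
  qed (simp add: loss_constant_def)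
  finally show ?thesis by (simp add: x_def \<theta>_def)
qed

text \<open>
Averaging the weights of the single degrees: each of them is at most \<open>R\<close> times the average, so a
monomial of degree \<open>r\<close> loses at most \<open>R\<^sup>r\<^sup>/\<^sup>p\<close> when its weights are replaced. The mixed estimate
for \<open>F\<^sub>r\<close> was used with the weights of degree \<open>r\<close> and is not affected.
\<close>

lemma common_weight:
  assumes F: "\<forall>r\<le>R. homogeneous_on n r (F r)" and R: "R \<ge> 1" and p: "2 * real R \<le> p"
  shows "\<exists>\<rho>. (\<forall>j. \<rho> j \<ge> 0) \<and> (\<Sum>j<n. \<rho> j) \<le> 1 \<and>
    (\<forall>r\<in>{1..R}. coeff_norm (q_exp r p) (F r)
      \<le> (real R powr (real r / p) * coeff_norm (q0_exp r) (rescale n (\<lambda>j. \<rho> j powr (1 / p)) (F r))) powr (1 - 2 * real r / p)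
        * (exp 1 * real r * sqrt 2 ^ r * sup_norm_lp_ball n p (\<Sum>r\<le>R. F r)) powr (2 * real r / p))"
proof -
  let ?M = "sup_norm_lp_ball n p (\<Sum>r\<le>R. F r)"
  have p0: "p > 0" using R p by linarith
  define good where "good = (\<lambda>r \<sigma>. (\<forall>j. \<sigma> j \<ge> 0) \<and> (\<Sum>j<n. \<sigma> j) \<le> 1 \<and>
    coeff_norm (q_exp r p) (F r) \<le> coeff_norm (q0_exp r) (rescale n (\<lambda>j. \<sigma> j powr (1 / p)) (F r)) powr (1 - 2 * real r / p)
      * (exp 1 * real r * sqrt 2 ^ r * ?M) powr (2 * real r / p))"
  have "\<exists>\<sigma>. good r \<sigma>" if r: "1 \<le> r" "r \<le> R" for r
  proof -
    have "2 * real r \<le> p" using r p by linarith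
    then obtain \<sigma> where "\<And>j. \<sigma> j \<ge> 0" "(\<Sum>j<n. \<sigma> j) \<le> 1"
      "coeff_norm (q_exp r p) (F r) \<le> coeff_norm (q0_exp r) (rescale n (\<lambda>j. \<sigma> j powr (1 / p)) (F r)) powr (1 - 2 * real r / p)
      * (exp 1 * real r * sqrt 2 ^ r * ?M) powr (2 * real r / p)"
      using coeff_norm_transfer[OF F[rule_format, OF r(2)] r(1) _ norm_peval_component_le[OF F p0 _ r(2)]] by blast
    thus ?thesis unfolding good_def by blast
  qed
  then obtain \<sigma> where \<sigma>: "\<And>r. 1 \<le> r \<Longrightarrow> r \<le> R \<Longrightarrow> good r (\<sigma> r)" by metis
  define \<rho> where "\<rho> = (\<lambda>j. (\<Sum>r=1..R. \<sigma> r j) / R)"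
  have \<sigma>0: "\<sigma> r j \<ge> 0" if "1 \<le> r" "r \<le> R" for r j using \<sigma>[OF that] by (simp add: good_def)
  show ?thesis
  proof (intro exI conjI allI ballI)
    show "\<rho> j \<ge> 0" for j unfolding \<rho>_def by (intro divide_nonneg_nonneg sum_nonneg \<sigma>0) auto
    have "(\<Sum>j<n. \<rho> j) = (\<Sum>r=1..R. \<Sum>j<n. \<sigma> r j) / R"
      unfolding \<rho>_def by (subst sum.swap) (simp add: sum_divide_distrib)
    also have "\<dots> \<le> (\<Sum>r=1..R. 1) / R"
      using \<sigma> by (intro divide_right_mono sum_mono) (auto simp: good_def)
    also have "\<dots> \<le> 1" by simp
    finally show "(\<Sum>j<n. \<rho> j) \<le> 1" .
    fix r assume "r \<in> {1..R}"
    hence r: "1 \<le> r" "r \<le> R" by auto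
    have \<theta>: "1 - 2 * real r / p \<ge> 0" using r p p0 by (simp add: field_simps)
    have weight: "\<sigma> r j powr (1 / p) \<le> real R powr (1 / p) * \<rho> j powr (1 / p)" for j
    proof -
      have "\<sigma> r j \<le> (\<Sum>r=1..R. \<sigma> r j)" using r \<sigma>0 by (intro member_le_sum) auto
      also have "\<dots> = real R * \<rho> j" using R by (simp add: \<rho>_def)
      finally have "\<sigma> r j powr (1 / p) \<le> (real R * \<rho> j) powr (1 / p)"
        using \<sigma>0[OF r] p0 by (intro powr_mono2) auto
      also have "\<dots> = real R powr (1 / p) * \<rho> j powr (1 / p)"
        by (rule powr_mult)
      finally show ?thesis .
    qed
    have cmp: "coeff_norm (q0_exp r) (rescale n (\<lambda>j. \<sigma> r j powr (1 / p)) (F r))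
      \<le> real R powr (real r / p) * coeff_norm (q0_exp r) (rescale n (\<lambda>j. \<rho> j powr (1 / p)) (F r))"
    proof (rule coeff_norm_le_scale)
      fix \<alpha>
      show "norm (Poly_Mapping.lookup (rescale n (\<lambda>j. \<sigma> r j powr (1 / p)) (F r)) \<alpha>)
        \<le> real R powr (real r / p) * norm (Poly_Mapping.lookup (rescale n (\<lambda>j. \<rho> j powr (1 / p)) (F r)) \<alpha>)"
      proof (cases "\<alpha> \<in> Poly_Mapping.keys (F r)")
        case True
        let ?l = "Poly_Mapping.lookup \<alpha>"
        have "(\<Prod>j<n. (\<sigma> r j powr (1 / p)) ^ ?l j) \<le> (\<Prod>j<n. (real R powr (1 / p) * \<rho> j powr (1 / p)) ^ ?l j)"
          by (intro prod_mono conjI power_mono weight) auto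
        also have "\<dots> = (real R powr (1 / p)) ^ r * (\<Prod>j<n. (\<rho> j powr (1 / p)) ^ ?l j)"
          using homogeneous_onD(3)[OF F[rule_format, OF r(2)] True]
          by (simp add: power_mult_distrib prod.distrib flip: power_sum)
        also have "(real R powr (1 / p)) ^ r = real R powr (real r / p)"
          using R by (simp add: powr_powr flip: powr_realpow)
        finally have "norm (Poly_Mapping.lookup (F r) \<alpha>) * (\<Prod>j<n. (\<sigma> r j powr (1 / p)) ^ ?l j)
            \<le> norm (Poly_Mapping.lookup (F r) \<alpha>) * (real R powr (real r / p) * (\<Prod>j<n. (\<rho> j powr (1 / p)) ^ ?l j))"
          by (rule mult_left_mono) simp
        thus ?thesis
          unfolding lookup_rescale norm_mult norm_of_real abs_prod by (simp add: mult_ac)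
      qed (simp add: lookup_rescale in_keys_iff)
    qed (use r in \<open>auto simp: q0_exp_def\<close>)
    have "coeff_norm (q_exp r p) (F r) \<le> coeff_norm (q0_exp r) (rescale n (\<lambda>j. \<sigma> r j powr (1 / p)) (F r)) powr (1 - 2 * real r / p)
      * (exp 1 * real r * sqrt 2 ^ r * ?M) powr (2 * real r / p)"
      using \<sigma>[OF r] by (simp add: good_def)
    also have "\<dots> \<le> (real R powr (real r / p) * coeff_norm (q0_exp r) (rescale n (\<lambda>j. \<rho> j powr (1 / p)) (F r))) powr (1 - 2 * real r / p)
        * (exp 1 * real r * sqrt 2 ^ r * ?M) powr (2 * real r / p)"
      by (intro mult_right_mono powr_mono2 \<theta> cmp coeff_norm_nonneg) auto
    finally show "coeff_norm (q_exp r p) (F r)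
      \<le> (real R powr (real r / p) * coeff_norm (q0_exp r) (rescale n (\<lambda>j. \<rho> j powr (1 / p)) (F r))) powr (1 - 2 * real r / p)
        * (exp 1 * real r * sqrt 2 ^ r * ?M) powr (2 * real r / p)" .
  qed
qed

theorem corollary7p3:
  fixes beta_star :: real
  assumes "beta_star < 2.47"
    and "weighted_graded_BH beta_star"
  shows "\<forall>c::real. c > 0 \<longrightarrow> (\<forall>B::real. B > beta_star + ln 2 / c \<longrightarrow>
    (\<exists>C::real. \<forall>R::nat. \<forall>p::real.
       R \<ge> 2 \<longrightarrow> 2 * real R \<le> p \<longrightarrow> p \<ge> c * (real R)\<^sup>2 / ln (real R) \<longrightarrow>
       (\<forall>n::nat. \<forall>F :: nat \<Rightarrow> cpoly.
          (\<forall>r\<le>R. homogeneous_on n r (F r)) \<longrightarrow>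
          sqrt (\<Sum>r=1..R. (coeff_norm (q_exp r p) (F r))\<^sup>2 / real r powr (2 * B))
            \<le> C * sup_norm_lp_ball n p (\<Sum>r\<le>R. F r))))"
proof (intro allI impI)
  fix c B :: real assume c: "c > 0" and B: "B > beta_star + ln 2 / c"
  \<comment> \<open>the gap \<open>X\<close> is split between Bohnenblust--Hille at \<open>b > beta_star\<close> and the slack \<open>\<delta>\<close>\<close>
  define X where "X = B - ln 2 / c - beta_star"
  define \<delta> where "\<delta> = min (1 / 2) (X / 2)"
  define b where "b = beta_star + (X - \<delta>)"
  have "X > 0" using B by (simp add: X_def)
  hence \<delta>: "0 < \<delta>" "\<delta> \<le> 1 / 2" and "\<delta> < X" by (auto simp: \<delta>_def min_def)
  hence "b > beta_star" by (simp add: b_def)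
  from assms(2)[unfolded weighted_graded_BH_def, THEN spec, THEN mp, OF this]
  obtain K where "\<forall>R\<ge>1. \<forall>n. \<forall>G :: nat \<Rightarrow> cpoly. (\<forall>r\<le>R. homogeneous_on n r (G r)) \<longrightarrow>
      sqrt (\<Sum>r=1..R. (coeff_norm (q0_exp r) (G r))\<^sup>2 / real r powr (2 * b))
        \<le> K * sup_norm_polydisc n (\<Sum>r\<le>R. G r)"
    by (rule exE)
  note K = this[rule_format]
  have B_eq: "B = b + ln 2 / c + \<delta>" by (simp add: b_def X_def)
  define C where "C = sqrt (loss_constant c b * (K\<^sup>2 + 1 / (c * \<delta>)))"
  show "\<exists>C::real. \<forall>R::nat. \<forall>p::real.
       R \<ge> 2 \<longrightarrow> 2 * real R \<le> p \<longrightarrow> p \<ge> c * (real R)\<^sup>2 / ln (real R) \<longrightarrow>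
       (\<forall>n::nat. \<forall>F :: nat \<Rightarrow> cpoly.
          (\<forall>r\<le>R. homogeneous_on n r (F r)) \<longrightarrow>
          sqrt (\<Sum>r=1..R. (coeff_norm (q_exp r p) (F r))\<^sup>2 / real r powr (2 * B))
            \<le> C * sup_norm_lp_ball n p (\<Sum>r\<le>R. F r))"
  proof (intro exI[of _ C] allI impI)
    fix R n :: nat and p :: real and F :: "nat \<Rightarrow> cpoly"
    assume R: "R \<ge> 2" and p: "2 * real R \<le> p" "p \<ge> c * (real R)\<^sup>2 / ln (real R)"
      and F: "\<forall>r\<le>R. homogeneous_on n r (F r)"
    hence F: "\<forall>r\<le>R. homogeneous_on n r (F r)" by blast
    let ?M = "sup_norm_lp_ball n p (\<Sum>r\<le>R. F r)"
    have p0: "p > 0" using R p by linarith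
    have "lp_norm n p (\<lambda>_. 0) \<le> 1" by (simp add: lp_norm_def)
    from norm_peval_le_sup_norm_lp_ball[OF F p0 this]
    have M0: "?M \<ge> 0" by (rule order_trans[OF norm_ge_zero])
    have R1: "R \<ge> 1" using R by simp
    from common_weight[OF F R1 p(1)] obtain \<rho> where \<rho>': "\<forall>j. \<rho> j \<ge> 0" "(\<Sum>j<n. \<rho> j) \<le> 1"
      and le: "\<forall>r\<in>{1..R}. coeff_norm (q_exp r p) (F r)
      \<le> (real R powr (real r / p) * coeff_norm (q0_exp r) (rescale n (\<lambda>j. \<rho> j powr (1 / p)) (F r))) powr (1 - 2 * real r / p)
        * (exp 1 * real r * sqrt 2 ^ r * ?M) powr (2 * real r / p)"
      by (elim exE conjE)
    note \<rho> = \<rho>'(1)[rule_format] \<rho>'(2)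
    define G where "G = (\<lambda>r. rescale n (\<lambda>j. \<rho> j powr (1 / p)) (F r))"
    define x where "x = (\<lambda>r. (coeff_norm (q0_exp r) (G r))\<^sup>2 / real r powr (2 * b))"
    have polydisc: "norm (peval (\<Sum>r\<le>R. G r) z) \<le> ?M" if z: "z \<in> {z. \<forall>j<n. norm (z j) \<le> 1}" for z
    proof -
      have "peval (\<Sum>r\<le>R. G r) z = peval (\<Sum>r\<le>R. F r) (\<lambda>j. of_real (\<rho> j powr (1 / p)) * z j)"
        unfolding peval_sum G_def by (intro sum.cong refl, rule peval_rescale[OF F[rule_format]]) simp
      moreover have "lp_norm n p (\<lambda>j. of_real (\<rho> j powr (1 / p)) * z j) \<le> 1"
        using z by (intro lp_norm_weights_le_1 p0 \<rho>) auto
      ultimately show ?thesis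
        using norm_peval_le_sup_norm_lp_ball[OF F p0] by simp
    qed
    have "sup_norm_polydisc n (\<Sum>r\<le>R. G r) \<le> ?M"
      unfolding sup_norm_polydisc_def
      by (rule cSUP_least[OF _ polydisc]) (auto intro!: exI[of _ "\<lambda>_. 0"])
    hence "\<bar>K\<bar> * sup_norm_polydisc n (\<Sum>r\<le>R. G r) \<le> \<bar>K\<bar> * ?M" by (rule mult_left_mono) simp
    moreover have "bdd_above ((\<lambda>z. norm (peval (\<Sum>r\<le>R. G r) z)) ` {z. \<forall>j<n. norm (z j) \<le> 1})"
      by (rule bdd_aboveI2[where M = ?M], rule polydisc)
    hence "0 \<le> sup_norm_polydisc n (\<Sum>r\<le>R. G r)"
      unfolding sup_norm_polydisc_def
      by (intro order_trans[OF norm_ge_zero cSUP_upper[of "\<lambda>_. 0"]]) auto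
    hence "K * sup_norm_polydisc n (\<Sum>r\<le>R. G r) \<le> \<bar>K\<bar> * sup_norm_polydisc n (\<Sum>r\<le>R. G r)"
      by (rule mult_right_mono[OF abs_ge_self])
    moreover have "sqrt (\<Sum>r=1..R. x r) \<le> K * sup_norm_polydisc n (\<Sum>r\<le>R. G r)"
      unfolding x_def by (rule K[OF R1]) (simp add: G_def homogeneous_on_rescale F[rule_format])
    ultimately have BH: "sqrt (\<Sum>r=1..R. x r) \<le> \<bar>K\<bar> * ?M" by linarith
    have "(\<Sum>r=1..R. x r) \<le> (\<bar>K\<bar> * ?M)\<^sup>2"
    proof -
      have "(sqrt (\<Sum>r=1..R. x r))\<^sup>2 \<le> (\<bar>K\<bar> * ?M)\<^sup>2"
        by (intro power_mono BH real_sqrt_ge_zero sum_nonneg) (simp add: x_def)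
      thus ?thesis by (simp add: x_def sum_nonneg)
    qed
    hence x_sum: "(\<Sum>r=1..R. x r) \<le> K\<^sup>2 * ?M\<^sup>2" by (simp add: power_mult_distrib)
    have "(\<Sum>r=1..R. (coeff_norm (q_exp r p) (F r))\<^sup>2 / real r powr (2 * B))
      \<le> (\<Sum>r=1..R. loss_constant c b * (x r + 2 * real r / p * real r powr (- 2 * \<delta>) * ?M\<^sup>2))"
    proof (rule sum_mono)
      fix r assume r: "r \<in> {1..R}"
      hence r': "1 \<le> r" "r \<le> R" by auto
      show "(coeff_norm (q_exp r p) (F r))\<^sup>2 / real r powr (2 * B)
        \<le> loss_constant c b * (x r + 2 * real r / p * real r powr (- 2 * \<delta>) * ?M\<^sup>2)"
        unfolding B_eq x_def G_def
        by (rule graded_term_le[OF c R r' p less_imp_le[OF \<delta>(1)] coeff_norm_nonneg M0 coeff_norm_nonneg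
              bspec[OF le r]])
    qed
    also have "\<dots> = loss_constant c b * ((\<Sum>r=1..R. x r) + (\<Sum>r=1..R. 2 * real r / p * real r powr (- 2 * \<delta>)) * ?M\<^sup>2)"
      by (simp only: sum.distrib sum_distrib_left[symmetric] sum_distrib_right[symmetric])
    also have "\<dots> \<le> loss_constant c b * (K\<^sup>2 * ?M\<^sup>2 + 1 / (c * \<delta>) * ?M\<^sup>2)"
      by (intro mult_left_mono add_mono x_sum mult_right_mono sum_interpolation_parameters_le c R \<delta> p0 p(2))
         (auto simp: loss_constant_def)
    also have "\<dots> = (loss_constant c b * (K\<^sup>2 + 1 / (c * \<delta>))) * ?M\<^sup>2" by (simp add: algebra_simps)
    finally have "sqrt (\<Sum>r=1..R. (coeff_norm (q_exp r p) (F r))\<^sup>2 / real r powr (2 * B))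
      \<le> sqrt ((loss_constant c b * (K\<^sup>2 + 1 / (c * \<delta>))) * ?M\<^sup>2)" by (rule real_sqrt_le_mono)
    also have "\<dots> = C * ?M" using M0 by (simp add: C_def real_sqrt_mult)
    finally show "sqrt (\<Sum>r=1..R. (coeff_norm (q_exp r p) (F r))\<^sup>2 / real r powr (2 * B)) \<le> C * ?M" .
  qed
qed

end
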